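(* Let $\tilde X=(\tilde x_1,\dots,\tilde x_N)\in\mathbb{R}^{n_{\tilde x}N}$, $U\in\mathbb{R}^{n_uN_u}$ and $S\in\mathbb{R}^{N_s}$ (with positive dilation factor, $\Gamma_s(\tau)S>0$ for $\tau\in[0,1]$) satisfy, for all $k=1,\dots,N-1$, $$F_k(\tilde x_{k+1},\tilde x_k,U,S)=0\qquad\text{and}\qquad E_y(\tilde x_{k+1}-\tilde x_k)=0 .$$ Then for every $k=1,\dots,N-1$, $$E_y\,\nabla_{\tilde x_{k+1}}F_k(\tilde x_{k+1},\tilde x_k,U,S)=[\,0_{1\times n_x}\ \ 1\ \ 0\,],$$ $$E_y\,\nabla_{\tilde x_{k}}F_k(\tilde x_{k+1},\tilde x_k,U,S)=[\,0_{1\times n_x}\ -1\ \ 0\,],$$ $$E_y\,\nabla_{U}F_k(\tilde x_{k+1},\tilde x_k,U,S)=0_{1\times n_uN_u},$$ $$E_y\,\nabla_{S}F_k(\tilde x_{k+1},\tilde x_k,U,S)=0_{1\times N_s}.$$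
   Context: Gradients of vector-valued functions are Jacobian matrices (gradients of the components as rows). $\mathbb{R}_+$ denotes the nonnegative reals. Data: $f:\mathbb{R}_+\times\mathbb{R}^{n_x}\times\mathbb{R}^{n_u}\to\mathbb{R}^{n_x}$, $g:\mathbb{R}_+\times\mathbb{R}^{n_x}\times\mathbb{R}^{n_u}\to\mathbb{R}^{n_g}$, $h:\mathbb{R}_+\times\mathbb{R}^{n_x}\times\mathbb{R}^{n_u}\to\mathbb{R}^{n_h}$ are continuously differentiable. Standing boundedness assumption: for any compact $\mathbb{U}\subset\mathbb{R}^{n_u}$ and $t_{\mathrm f}>t_{\mathrm i}\ge0$ there are positive $\vartheta,\varrho$ with $\|f(t,x,u)\|\le\vartheta\|x\|+\varrho$ for all $(t,x,u)\in[t_{\mathrm i},t_{\mathrm f}]\times\mathbb{R}^{n_x}\times\mathbb{U}$. Penalty: $q_i:\mathbb{R}\to\mathbb{R}_+$ and $p_j:\mathbb{R}\to\mathbb{R}_+$ are continuously differentiable with $q_i(z)=0$ for $z\le0$, $q_i(z)>0$ for $z>0$, $p_j(0)=0$, $p_j(z)>0$ for $z\neq0$, and $\Lambda(t,x,u)=\sum_{i=1}^{n_g}q_i(g_i(t,x,u))+\sum_{j=1}^{n_h}p_j(h_j(t,x,u))$. Augmented system: the augmented state is $\tilde x=(x,y,t)\in\mathbb{R}^{n_{\tilde x}}$, $n_{\tilde x}=n_x+2$, with $x\in\mathbb{R}^{n_x}$, $y,t\in\mathbb{R}$; the augmented control is $\tilde u=(u,s)\in\mathbb{R}^{n_u+1}$,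 where $s$ is called the dilation factor and is required to be positive. $E_x,E_y,E_t$ are the selector matrices with $E_x\tilde x=x$, $E_y\tilde x=y$ (penultimate entry), $E_t\tilde x=t$. The augmented dynamics on $[0,1]$ are $\frac{\mathrm d\tilde x}{\mathrm d\tau}=F(\tilde x,\tilde u)$ with $$F(\tilde x,\tilde u)=\begin{bmatrix}f(t,x,u)\\ \Lambda(t,x,u)\\ 1\end{bmatrix}s .$$ Control parameterization: $\Gamma_u=[\Gamma_u^1\cdots\Gamma_u^{N_u}]$ and $\Gamma_s=[\Gamma_s^1\cdots\Gamma_s^{N_s}]$ are row vectors of (piecewise) polynomial basis functions $[0,1]\to\mathbb{R}$ (supports may be strict subsets of $[0,1]$), and $\tilde\nu(\tau)=\big((\Gamma_u(\tau)\otimes I_{n_u})U,\ \Gamma_s(\tau)S\big)$, which is piecewise continuous. Discretization: $0=\tau_1<\dots<\tau_N=1$, and for $k=1,\dots,N-1$ $$F_k(\tilde x_{k+1},\tilde x_k,U,S)=\tilde x_{k+1}-\tilde x_k-\int_{\tau_k}^{\tau_{k+1}}F(\tilde x^k(\tau),\tilde\nu(\tau))\,\mathrm d\tau\in\mathbb{R}^{n_{\tilde x}},$$ where $\tilde x^k$ is the solution on $[\tau_k,\tau_{k+1}]$ of $\frac{\mathrm d\tilde x^k}{\mathrm d\tau}=F(\tilde x^k,\tilde\nu)$ (a.e.) with $\tilde x^k(\tau_k)=\tilde x_k$. *)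

theory Defs
  imports "HOL-Analysis.Analysis" "HOL-Computational_Algebra.Polynomial"
begin

text \<open>Continuous differentiability on a set that need not be open: derivatives are taken within the
  set, i.e. one-sided at the boundary. It is applied to the closed half-space of nonnegative times.\<close>

definition continuously_differentiable_on ::
  "('a::real_normed_vector \<Rightarrow> 'b::real_normed_vector) \<Rightarrow> 'a set \<Rightarrow> bool" where
  "continuously_differentiable_on f D \<longleftrightarrow>
     (\<exists>f'. (\<forall>z\<in>D. (f has_derivative blinfun_apply (f' z)) (at z within D)) \<and> continuous_on D f')"

text \<open>The values at the finitely many breakpoints are unrestricted.\<close>

definition piecewise_polynomial_on :: "real set \<Rightarrow> (real \<Rightarrow> real) \<Rightarrow> bool" where
  "piecewise_polynomial_on I \<phi> \<longleftrightarrow>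
     (\<exists>K. finite K \<and>
        (\<forall>a b. {a<..<b} \<subseteq> I - K \<longrightarrow> (\<exists>P. \<forall>\<tau>\<in>{a<..<b}. \<phi> \<tau> = poly P \<tau>)))"

definition penalty ::
  "('ng::finite \<Rightarrow> real \<Rightarrow> real) \<Rightarrow> ('nh::finite \<Rightarrow> real \<Rightarrow> real) \<Rightarrow>
   (real \<times> (real^'nx) \<times> (real^'nu) \<Rightarrow> real^'ng) \<Rightarrow>
   (real \<times> (real^'nx) \<times> (real^'nu) \<Rightarrow> real^'nh) \<Rightarrow>
   real \<times> (real^'nx) \<times> (real^'nu) \<Rightarrow> real" where
  "penalty q p g h z = (\<Sum>i\<in>UNIV. q i (g z $ i)) + (\<Sum>j\<in>UNIV. p j (h z $ j))"

text \<open>An augmented state \<open>(x, y, t)\<close> is a vector over the index type \<open>'nx + 2\<close>: the indices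
  \<open>Inl i\<close> carry \<open>x\<close>, the index \<open>Inr 0\<close> carries \<open>y\<close> and \<open>Inr 1\<close> carries \<open>t\<close>, where \<open>0\<close> and \<open>1\<close> are
  the two elements of the type \<open>2\<close>.\<close>

definition aug :: "real^'nx \<Rightarrow> real \<Rightarrow> real \<Rightarrow> real^('nx + 2)" where
  "aug x y t = (\<chi> c. case c of Inl i \<Rightarrow> x $ i | Inr j \<Rightarrow> (if j = 0 then y else t))"

definition E_x :: "real^('nx::finite + 2)^'nx" where
  "E_x = (\<chi> i c. if c = Inl i then 1 else 0)"

definition E_y :: "real^('nx::finite + 2)^1" where
  "E_y = (\<chi> i c. if c = Inr 0 then 1 else 0)"

definition E_t :: "real^('nx::finite + 2)^1" where
  "E_t = (\<chi> i c. if c = Inr 1 then 1 else 0)"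

lemma selectors_aug:
  "E_x *v aug x y t = x" "E_y *v aug x y t = vec y" "E_t *v aug x y t = vec t"
  by (simp_all add: E_x_def E_y_def E_t_def aug_def matrix_vector_mult_def vec_eq_iff
        if_distrib[of "\<lambda>a. a * _"] sum.delta cong: if_cong)

definition aug_rhs ::
  "(real \<times> (real^'nx) \<times> (real^'nu) \<Rightarrow> real^'nx) \<Rightarrow>
   (real \<times> (real^'nx) \<times> (real^'nu) \<Rightarrow> real) \<Rightarrow>
   real^('nx::finite + 2) \<Rightarrow> (real^'nu) \<times> real \<Rightarrow> real^('nx + 2)" where
  "aug_rhs f \<Lambda> X w =
     (let z = ((E_t *v X) $ 1, E_x *v X, fst w) in snd w *\<^sub>R aug (f z) (\<Lambda> z) 1)"

text \<open>\<open>U\<close> is stacked blockwise, \<open>U $ (j, i)\<close> being entry \<open>i\<close> of the \<open>j\<close>-th block, so that the first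
  component below is \<open>(\<Gamma>\<^sub>u(\<tau>) \<otimes> I) U\<close>.\<close>

definition control ::
  "(real \<Rightarrow> real^'Nu) \<Rightarrow> (real \<Rightarrow> real^'Ns) \<Rightarrow> real^('Nu \<times> 'nu) \<Rightarrow> real^'Ns \<Rightarrow>
   real \<Rightarrow> (real^'nu) \<times> real" where
  "control \<Gamma>u \<Gamma>s U S \<tau> = ((\<chi> i. \<Sum>j\<in>UNIV. \<Gamma>u \<tau> $ j * U $ (j, i)), \<Gamma>s \<tau> \<bullet> S)"

text \<open>Solutions for piecewise continuous controls: continuous, and satisfying the differential
  equation except at finitely many points. Since the data are only given for nonnegative times, the
  time component of a solution has to be nonnegative.\<close>

definition is_trajectory ::
  "(real^('nx::finite + 2) \<Rightarrow> 'w \<Rightarrow> real^('nx + 2)) \<Rightarrow> (real \<Rightarrow> 'w) \<Rightarrow> real \<Rightarrow> real \<Rightarrow>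
   real^('nx + 2) \<Rightarrow> (real \<Rightarrow> real^('nx + 2)) \<Rightarrow> bool" where
  "is_trajectory F \<nu> a b x \<xi> \<longleftrightarrow>
     continuous_on {a..b} \<xi> \<and> \<xi> a = x \<and> (\<forall>\<tau>\<in>{a..b}. 0 \<le> (E_t *v \<xi> \<tau>) $ 1) \<and>
     (\<exists>K. finite K \<and>
        (\<forall>\<tau>\<in>{a..b} - K. (\<xi> has_vector_derivative F (\<xi> \<tau>) (\<nu> \<tau>)) (at \<tau> within {a..b})))"

text \<open>Any two solutions agree on \<open>{a..b}\<close>, but their values elsewhere are arbitrary, whence the
  choice operator.\<close>

definition trajectory ::
  "(real^('nx::finite + 2) \<Rightarrow> 'w \<Rightarrow> real^('nx + 2)) \<Rightarrow> (real \<Rightarrow> 'w) \<Rightarrow> real \<Rightarrow> real \<Rightarrow>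
   real^('nx + 2) \<Rightarrow> real \<Rightarrow> real^('nx + 2)" where
  "trajectory F \<nu> a b x = (SOME \<xi>. is_trajectory F \<nu> a b x \<xi>)"

text \<open>The constraint function \<open>F\<^sub>k\<close> on the subinterval \<open>{a..b}\<close>. Its last three arguments
  \<open>(x, U, S)\<close> have to lie in the set \<open>defect_dom\<close> for which the solution exists.\<close>

definition defect ::
  "(real^('nx::finite + 2) \<Rightarrow> (real^'nu) \<times> real \<Rightarrow> real^('nx + 2)) \<Rightarrow>
   (real \<Rightarrow> real^'Nu) \<Rightarrow> (real \<Rightarrow> real^'Ns) \<Rightarrow> real \<Rightarrow> real \<Rightarrow>
   real^('nx + 2) \<Rightarrow> real^('nx + 2) \<Rightarrow> real^('Nu \<times> 'nu) \<Rightarrow> real^'Ns \<Rightarrow> real^('nx + 2)" where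
  "defect F \<Gamma>u \<Gamma>s a b xnext x U S =
     (let \<nu> = control \<Gamma>u \<Gamma>s U S
      in xnext - x - integral {a..b} (\<lambda>\<tau>. F (trajectory F \<nu> a b x \<tau>) (\<nu> \<tau>)))"

definition defect_dom ::
  "(real^('nx::finite + 2) \<Rightarrow> (real^'nu) \<times> real \<Rightarrow> real^('nx + 2)) \<Rightarrow>
   (real \<Rightarrow> real^'Nu) \<Rightarrow> (real \<Rightarrow> real^'Ns) \<Rightarrow> real \<Rightarrow> real \<Rightarrow>
   ((real^('nx + 2)) \<times> (real^('Nu \<times> 'nu)) \<times> (real^'Ns)) set" where
  "defect_dom F \<Gamma>u \<Gamma>s a b = {(x, U, S). \<exists>\<xi>. is_trajectory F (control \<Gamma>u \<Gamma>s U S) a b x \<xi>}"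

end

theory Submission
  imports Defs
begin

text \<open>Let \<open>\<Phi> (x, U, S)\<close> be the end point of the trajectory on \<open>{a..b}\<close> that starts in \<open>x\<close>. Wherever the
  trajectory exists, the constraint function is \<open>F\<^sub>k x' x U S = x' - \<Phi> (x, U, S)\<close>, so the claim is
  about the \<open>y\<close> row of the derivative of \<open>\<Phi>\<close>.

  The component \<open>y\<close> grows at the rate \<open>s * \<Lambda> \<ge> 0\<close>. It returns to its initial value and \<open>s\<close> is
  positive, so \<open>\<Lambda>\<close> vanishes along the trajectory except at finitely many times
  (\<open>penalty_rate_zero\<close>). Now \<open>\<Lambda>\<close> is a sum of terms \<open>\<phi> \<circ> \<gamma>\<close> with a scalar \<open>\<phi> \<ge> 0\<close>. Where the sum
  vanishes, each \<open>\<phi>\<close> is at a minimum, so its derivative is \<open>0\<close>, and by the chain rule so is the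
  derivative of \<open>\<Lambda>\<close> (\<open>penalty_has_derivative_0\<close>). Hence the \<open>y\<close> row of the linearized dynamics is
  zero along the trajectory, the \<open>y\<close> component of every solution of the variational equation is
  constant, and the \<open>y\<close> component of the derivative of \<open>\<Phi>\<close> in the direction \<open>(\<delta>x, \<delta>U, \<delta>S)\<close> is that of
  \<open>\<delta>x\<close> (\<open>endpoint_map_has_derivative\<close>).

  Two points need work. First, \<open>\<Phi>\<close> has to be differentiable within the set of those parameters for
  which the trajectory exists. This is \<open>endpoint_has_derivative\<close>: solutions for nearby data stay in a
  compact convex tube around the reference solution, Gronwall's inequality compares them with it to
  first order, and the variational equation is solvable by the Banach fixed point theorem.

  Secondly, a Jacobian within a set is only meaningful if the derivative within that set is
  unique. It is enough that the set contains arbitrarily short steps along every coordinate axis, in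
  one of the two directions (\<open>selector_mult_jacobian\<close>). Linear growth of \<open>f\<close> makes the trajectory exist
  whenever the time component stays nonnegative (\<open>trajectory_exists\<close>), which settles the cases of \<open>x\<close>
  and \<open>U\<close>. For \<open>S\<close> the initial time may be \<open>0\<close> and the positive dilation factor may tend to \<open>0\<close> at the
  left end of the interval, so that a small change of \<open>S\<close> can make time negative. But the
  entries of \<open>\<Gamma>\<^sub>s\<close>, being piecewise polynomials, have constant sign right of that end, and a step
  along an axis in the direction that does not decrease the dilation factor there is admissible
  (\<open>perturbed_integral_nonneg\<close>).\<close>

section \<open>Gronwall's inequality and the continuity argument\<close>

lemma gronwall:
  fixes u :: "real \<Rightarrow> real"
  assumes cont: "continuous_on {a..b} u" and L: "0 \<le> L"
    and bound: "\<And>t. t \<in> {a..b} \<Longrightarrow> u t \<le> A + L * integral {a..t} u"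
    and t: "t \<in> {a..b}"
  shows "u t \<le> A * exp (L * (t - a))"
proof -
  \<comment> \<open>The weight turns the integral inequality into monotonicity of \<open>v\<close>.\<close>
  define v where "v s = exp (- L * (s - a)) * (A + L * integral {a..s} u)" for s
  have der: "(v has_real_derivative
      exp (- L * (s - a)) * (L * u s) + (- L * exp (- L * (s - a))) * (A + L * integral {a..s} u))
      (at s within {a..b})" if "s \<in> {a..b}" for s
  proof -
    have "((\<lambda>s. integral {a..s} u) has_real_derivative u s) (at s within {a..b})"
      by (rule integral_has_real_derivative[OF cont that])
    then have I: "((\<lambda>s. A + L * integral {a..s} u) has_real_derivative L * u s) (at s within {a..b})"
      by (auto intro!: derivative_eq_intros)
    have "((\<lambda>s. exp (- L * (s - a))) has_real_derivative - L * exp (- L * (s - a))) (at s within {a..b})"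
      by (auto intro!: derivative_eq_intros)
    from DERIV_mult[OF this I] show ?thesis
      unfolding v_def by (simp add: algebra_simps)
  qed
  have "v t \<le> v a"
  proof (rule DERIV_nonpos_imp_decreasing_open[of a t v])
    show "a \<le> t" using t by simp
    show "continuous_on {a..t} v"
      using DERIV_continuous_on[OF der] t by (meson atLeastAtMost_iff atLeastatMost_subset_iff continuous_on_subset order_refl)
    fix s assume s: "a < s" "s < t"
    have "u s - (A + L * integral {a..s} u) \<le> 0" using bound[of s] s t by simp
    then have "exp (- L * (s - a)) * L * (u s - (A + L * integral {a..s} u)) \<le> 0"
      using L by (simp add: mult_nonneg_nonpos)
    then have "exp (- L * (s - a)) * (L * u s) + (- L * exp (- L * (s - a))) * (A + L * integral {a..s} u) \<le> 0"
      by (simp add: algebra_simps)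
    moreover have "at s within {a..b} = at s" using s t by (simp add: at_within_Icc_at)
    ultimately show "\<exists>y. DERIV v s :> y \<and> y \<le> 0" using der[of s] s t by force
  qed
  then have "exp (- L * (t - a)) * (A + L * integral {a..t} u) \<le> A" by (simp add: v_def)
  then have "exp (L * (t - a)) * (exp (- L * (t - a)) * (A + L * integral {a..t} u)) \<le> exp (L * (t - a)) * A"
    by simp
  moreover have "exp (L * (t - a)) * exp (- L * (t - a)) = 1" by (simp add: exp_add[symmetric])
  ultimately have "A + L * integral {a..t} u \<le> A * exp (L * (t - a))"
    by (metis mult.assoc mult.commute mult.right_neutral)
  then show ?thesis using bound[OF t] by simp
qed

lemma gronwall_has_integral:
  fixes e :: "real \<Rightarrow> 'a::banach"
  assumes cont: "continuous_on {a..b} e" and L: "0 \<le> L" "0 \<le> k"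
    and int: "\<And>t. t \<in> {a..b} \<Longrightarrow> (\<phi> has_integral (e t - e\<^sub>0)) {a..t}"
    and bound: "\<And>\<sigma>. \<sigma> \<in> {a..b} \<Longrightarrow> norm (\<phi> \<sigma>) \<le> L * norm (e \<sigma>) + k"
    and start: "norm e\<^sub>0 \<le> m" and t: "t \<in> {a..b}"
  shows "norm (e t) \<le> (m + k * (b - a)) * exp (L * (b - a))"
proof -
  have "norm (e t) \<le> (m + k * (b - a)) * exp (L * (t - a))"
  proof (rule gronwall[OF _ L(1) _ t])
    show "continuous_on {a..b} (\<lambda>t. norm (e t))" using cont by (intro continuous_intros)
    fix s assume s: "s \<in> {a..b}"
    have ci: "(\<lambda>\<sigma>. norm (e \<sigma>)) integrable_on {a..s}"
      using s continuous_on_subset[OF cont, of "{a..s}"]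
      by (intro integrable_continuous_real continuous_intros) auto
    have "norm (integral {a..s} \<phi>) \<le> integral {a..s} (\<lambda>\<sigma>. L * norm (e \<sigma>) + k)"
      using int[OF s] ci bound s
      by (intro Henstock_Kurzweil_Integration.integral_norm_bound_integral integrable_add
          integrable_on_mult_right) (auto simp: has_integral_integrable)
    also have "\<dots> = L * integral {a..s} (\<lambda>\<sigma>. norm (e \<sigma>)) + k * (s - a)"
      using ci s by (subst integral_add) (auto intro: integrable_on_mult_right)
    also have "\<dots> \<le> L * integral {a..s} (\<lambda>\<sigma>. norm (e \<sigma>)) + k * (b - a)"
      using s L by (auto intro!: mult_left_mono)
    finally have "norm (e s - e\<^sub>0) \<le> L * integral {a..s} (\<lambda>\<sigma>. norm (e \<sigma>)) + k * (b - a)"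
      using integral_unique[OF int[OF s]] by simp
    then show "norm (e s) \<le> m + k * (b - a) + L * integral {a..s} (\<lambda>\<sigma>. norm (e \<sigma>))"
      using norm_triangle_ineq[of "e s - e\<^sub>0" e\<^sub>0] start by simp
  qed
  also have "\<dots> \<le> (m + k * (b - a)) * exp (L * (b - a))"
  proof (intro mult_left_mono)
    show "exp (L * (t - a)) \<le> exp (L * (b - a))" using t L by (auto intro: mult_left_mono)
    have "0 \<le> m" using start norm_ge_zero[of e\<^sub>0] by linarith
    then show "0 \<le> m + k * (b - a)" using t L by auto
  qed
  finally show ?thesis .
qed

text \<open>To confine a continuous quantity below a level on all of \<open>{a..b}\<close> it is enough to improve the weak
  bound to a strict one on initial segments: otherwise consider the first time at which the level is
  reached.\<close>

lemma continuity_argument_less: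
  fixes d :: "real \<Rightarrow> real"
  assumes cont: "continuous_on {a..b} d" and start: "d a < r"
    and improve: "\<And>c. c \<in> {a..b} \<Longrightarrow> (\<And>s. s \<in> {a..c} \<Longrightarrow> d s \<le> r) \<Longrightarrow> d c < r"
    and t: "t \<in> {a..b}"
  shows "d t < r"
proof (rule ccontr)
  assume not: "\<not> d t < r"
  define T where "T = {s \<in> {a..b}. d s \<in> {r..}}"
  have "closed T"
    unfolding T_def using continuous_closed_preimage[OF cont, of "{r..}"] by (simp add: vimage_def Int_def)
  then have "compact T"
    using compact_Int_closed[of "{a..b}" T] by (simp add: T_def Int_def conj_ac)
  moreover have "T \<noteq> {}" using not t by (auto simp: T_def)
  ultimately obtain c where c: "c \<in> T" "\<And>s. s \<in> T \<Longrightarrow> c \<le> s"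
    using compact_attains_inf by metis
  have cab: "c \<in> {a..b}" "r \<le> d c" using c by (auto simp: T_def)
  have below: "d s < r" if "s \<in> {a..<c}" for s
    using c(2)[of s] that cab by (force simp: T_def)
  have "a < c" using cab start by (cases "a = c") auto
  obtain s where s: "a \<le> s" "s \<le> c" "d s = r"
    using IVT'[of d a r c] start cab continuous_on_subset[OF cont, of "{a..c}"] by auto
  \<comment> \<open>By minimality of \<open>c\<close> the level \<open>r\<close> is reached at \<open>c\<close> and not exceeded before.\<close>
  then have "s = c" using below[of s] by force
  then have "d s' \<le> r" if "s' \<in> {a..c}" for s'
    using below[of s'] s that by (cases "s' = c") auto
  then have "d c < r" using improve cab by blast
  then show False using cab by simp
qed

section \<open>Piecewise continuous functions\<close>

text \<open>Boundedness is part of the notion instead of the existence of one-sided limits: together with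
  finitely many discontinuities it is all that integration needs, and it is easily seen to be stable
  under pairing and under continuous maps on closed sets.\<close>

definition piecewise_continuous_on :: "real \<Rightarrow> real \<Rightarrow> (real \<Rightarrow> 'a::metric_space) \<Rightarrow> bool" where
  "piecewise_continuous_on a b \<phi> \<longleftrightarrow>
     bounded (\<phi> ` {a..b}) \<and> (\<exists>K. finite K \<and> continuous_on ({a..b} - K) \<phi>)"

lemma continuous_imp_piecewise_continuous_on:
  "continuous_on {a..b} \<phi> \<Longrightarrow> piecewise_continuous_on a b \<phi>"
  unfolding piecewise_continuous_on_def
  by (auto intro!: exI[of _ "{}"] compact_imp_bounded compact_continuous_image)

lemma piecewise_continuous_on_subset:
  assumes "piecewise_continuous_on a b \<phi>" "a \<le> c" "d \<le> b"
  shows "piecewise_continuous_on c d \<phi>"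
proof -
  have "{c..d} \<subseteq> {a..b}" using assms by auto
  then show ?thesis
    using assms(1) unfolding piecewise_continuous_on_def
    by (meson bounded_subset continuous_on_subset image_mono Diff_mono order_refl)
qed

lemma piecewise_continuous_on_Pair:
  assumes "piecewise_continuous_on a b \<phi>" "piecewise_continuous_on a b \<psi>"
  shows "piecewise_continuous_on a b (\<lambda>\<sigma>. (\<phi> \<sigma>, \<psi> \<sigma>))"
proof -
  obtain K K' where K: "finite K" "continuous_on ({a..b} - K) \<phi>"
    and K': "finite K'" "continuous_on ({a..b} - K') \<psi>"
    using assms by (auto simp: piecewise_continuous_on_def)
  have "continuous_on ({a..b} - (K \<union> K')) (\<lambda>\<sigma>. (\<phi> \<sigma>, \<psi> \<sigma>))"
    by (intro continuous_on_Pair continuous_on_subset[OF K(2)] continuous_on_subset[OF K'(2)]) auto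
  moreover have "bounded (\<phi> ` {a..b} \<times> \<psi> ` {a..b})"
    using assms by (intro bounded_Times) (auto simp: piecewise_continuous_on_def)
  then have "bounded ((\<lambda>\<sigma>. (\<phi> \<sigma>, \<psi> \<sigma>)) ` {a..b})"
    by (rule bounded_subset) auto
  ultimately show ?thesis
    using K(1) K'(1) unfolding piecewise_continuous_on_def by blast
qed

text \<open>Closedness of \<open>T\<close> is what keeps the image bounded: the closure of the range of \<open>\<phi>\<close> is a compact
  subset of \<open>T\<close>.\<close>

lemma piecewise_continuous_on_compose:
  fixes \<phi> :: "real \<Rightarrow> 'a::heine_borel"
  assumes g: "continuous_on T g" and T: "closed T"
    and \<phi>: "piecewise_continuous_on a b \<phi>" and into: "\<And>\<sigma>. \<sigma> \<in> {a..b} \<Longrightarrow> \<phi> \<sigma> \<in> T"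
  shows "piecewise_continuous_on a b (\<lambda>\<sigma>. g (\<phi> \<sigma>))"
proof -
  obtain K where K: "finite K" "continuous_on ({a..b} - K) \<phi>"
    using \<phi> by (auto simp: piecewise_continuous_on_def)
  have sub: "closure (\<phi> ` {a..b}) \<subseteq> T"
    using T into by (intro closure_minimal) auto
  have "compact (closure (\<phi> ` {a..b}))"
    using \<phi> by (auto simp: piecewise_continuous_on_def compact_closure)
  then have "compact (g ` closure (\<phi> ` {a..b}))"
    using continuous_on_subset[OF g sub] by (rule compact_continuous_image[rotated])
  then have "bounded ((\<lambda>\<sigma>. g (\<phi> \<sigma>)) ` {a..b})"
    by (rule bounded_subset[OF compact_imp_bounded]) (use closure_subset in blast)
  moreover have "continuous_on ({a..b} - K) (\<lambda>\<sigma>. g (\<phi> \<sigma>))"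
    by (rule continuous_on_compose2[OF g K(2)]) (use into in auto)
  ultimately show ?thesis
    using K(1) by (auto simp: piecewise_continuous_on_def)
qed

lemma piecewise_continuous_on_compose_UNIV:
  fixes \<phi> :: "real \<Rightarrow> 'a::heine_borel"
  assumes "continuous_on UNIV g" "piecewise_continuous_on a b \<phi>"
  shows "piecewise_continuous_on a b (\<lambda>\<sigma>. g (\<phi> \<sigma>))"
  using piecewise_continuous_on_compose[OF assms(1) closed_UNIV assms(2)] by simp

lemma piecewise_continuous_on_vec:
  fixes \<phi> :: "real \<Rightarrow> real^'n"
  assumes "\<And>i. piecewise_continuous_on a b (\<lambda>\<sigma>. \<phi> \<sigma> $ i)"
  shows "piecewise_continuous_on a b \<phi>"
proof -
  have "\<exists>K. finite K \<and> continuous_on ({a..b} - K) (\<lambda>\<sigma>. \<phi> \<sigma> $ i)" for i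
    using assms by (simp add: piecewise_continuous_on_def)
  then obtain K where K: "\<And>i. finite (K i)" "\<And>i. continuous_on ({a..b} - K i) (\<lambda>\<sigma>. \<phi> \<sigma> $ i)"
    by metis
  have "\<exists>M. \<forall>\<sigma>\<in>{a..b}. \<bar>\<phi> \<sigma> $ i\<bar> \<le> M" for i
    using assms[of i] unfolding piecewise_continuous_on_def bounded_iff by auto
  then obtain M where M: "\<And>i \<sigma>. \<sigma> \<in> {a..b} \<Longrightarrow> \<bar>\<phi> \<sigma> $ i\<bar> \<le> M i" by metis
  have "norm (\<phi> \<sigma>) \<le> sum M UNIV" if "\<sigma> \<in> {a..b}" for \<sigma>
    using norm_le_l1_cart[of "\<phi> \<sigma>"] sum_mono[of UNIV "\<lambda>i. \<bar>\<phi> \<sigma> $ i\<bar>" M] M[OF that] by force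
  then have "bounded (\<phi> ` {a..b})" unfolding bounded_iff by blast
  moreover have "continuous_on ({a..b} - (\<Union>i. K i)) \<phi>"
  proof -
    have "continuous_on ({a..b} - (\<Union>i. K i)) (\<lambda>\<sigma>. \<chi> i. \<phi> \<sigma> $ i)"
      by (intro continuous_on_vec_lambda continuous_on_subset[OF K(2)]) auto
    then show ?thesis by simp
  qed
  moreover have "finite (\<Union>i. K i)" using K(1) by simp
  ultimately show ?thesis unfolding piecewise_continuous_on_def by blast
qed

lemma piecewise_continuous_on_integrable:
  fixes \<phi> :: "real \<Rightarrow> 'a::euclidean_space"
  assumes "piecewise_continuous_on a b \<phi>"
  shows "\<phi> integrable_on {a..b}"
proof -
  obtain K where K: "finite K" "continuous_on ({a..b} - K) \<phi>"
    using assms by (auto simp: piecewise_continuous_on_def)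
  obtain M where M: "\<And>\<sigma>. \<sigma> \<in> {a..b} \<Longrightarrow> norm (\<phi> \<sigma>) \<le> M"
    using assms unfolding piecewise_continuous_on_def bounded_iff by blast
  have neg: "negligible ({a..b} \<inter> K)" "negligible K"
    using K by (auto intro: negligible_finite)
  have S: "{a..b} - K \<in> sets lebesgue"
    using K(1) by (simp add: finite_imp_closed borel_closed sets.Diff)
  have "\<phi> integrable_on ({a..b} - K)"
  proof (rule measurable_bounded_by_integrable_imp_integrable)
    show "\<phi> \<in> borel_measurable (lebesgue_on ({a..b} - K))"
      using K(2) S by (rule continuous_imp_measurable_on_sets_lebesgue)
    show "(\<lambda>_. M) integrable_on ({a..b} - K)"
      by (rule integrable_spike_set[of _ "{a..b}"]) (auto intro: negligible_subset[OF neg(2)])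
    show "norm (\<phi> \<sigma>) \<le> M" if "\<sigma> \<in> {a..b} - K" for \<sigma>
      using M that by simp
  qed (rule S)
  then show ?thesis
    by (rule integrable_spike_set) (auto intro: negligible_subset[OF neg(2)])
qed

lemma has_integral_start:
  fixes \<xi> :: "real \<Rightarrow> 'a::banach"
  assumes "a \<le> b" "\<And>t. t \<in> {a..b} \<Longrightarrow> (\<phi> has_integral (\<xi> t - x)) {a..t}"
  shows "\<xi> a = x"
proof -
  have 1: "(\<phi> has_integral (\<xi> a - x)) {a..a}" using assms(1) by (intro assms(2)) simp
  have 2: "(\<phi> has_integral 0) {a..a}" using has_integral_refl(2)[of \<phi> a] by simp
  show ?thesis using has_integral_unique[OF 1 2] by simp
qed

lemma at_within_Diff_finite:
  fixes x :: "'a::t1_space"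
  assumes "finite K" "x \<notin> K"
  shows "at x within (S - K) = at x within S"
proof (rule at_within_nhd)
  show "x \<in> - K" "open (- K)" using assms by (auto simp: finite_imp_closed open_Compl)
qed auto

text \<open>A solution of the integral equation solves the differential equation wherever the integrand is
  continuous.\<close>

lemma has_vector_derivative_of_has_integral:
  fixes \<phi> :: "real \<Rightarrow> 'a::euclidean_space"
  assumes pc: "piecewise_continuous_on a b \<phi>"
    and int: "\<And>t. t \<in> {a..b} \<Longrightarrow> (\<phi> has_integral (\<xi> t - x)) {a..t}"
  shows "continuous_on {a..b} \<xi>"
    and "\<exists>K. finite K \<and> (\<forall>t\<in>{a..b} - K. (\<xi> has_vector_derivative \<phi> t) (at t within {a..b}))"
proof -
  have \<xi>: "\<xi> t = x + integral {a..t} \<phi>" if "t \<in> {a..b}" for t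
    using integral_unique[OF int[OF that]] by simp
  have \<phi>: "\<phi> integrable_on {a..b}" by (rule piecewise_continuous_on_integrable[OF pc])
  have "continuous_on {a..b} (\<lambda>t. x + integral {a..t} \<phi>)"
    by (intro continuous_intros indefinite_integral_continuous_1 \<phi>)
  then show "continuous_on {a..b} \<xi>"
    by (rule continuous_on_eq) (simp add: \<xi>)
  obtain K where K: "finite K" "continuous_on ({a..b} - K) \<phi>"
    using pc by (auto simp: piecewise_continuous_on_def)
  have "(\<xi> has_vector_derivative \<phi> t) (at t within {a..b})" if t: "t \<in> {a..b} - K" for t
  proof -
    have "((\<lambda>u. integral {a..u} \<phi>) has_vector_derivative \<phi> t) (at t within ({a..b} - K))"
      using integral_has_vector_derivative_continuous_at[OF \<phi> t K(1)] K(2) t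
      by (simp add: continuous_on_eq_continuous_within)
    then have "((\<lambda>u. x + integral {a..u} \<phi>) has_vector_derivative 0 + \<phi> t) (at t within {a..b})"
      using t K(1) by (intro derivative_intros) (simp add: at_within_Diff_finite)
    then have "((\<lambda>u. x + integral {a..u} \<phi>) has_vector_derivative \<phi> t) (at t within {a..b})"
      by simp
    then show ?thesis
      by (rule has_vector_derivative_transform[rotated 2]) (use t \<xi> in auto)
  qed
  with K(1) show "\<exists>K. finite K \<and> (\<forall>t\<in>{a..b} - K. (\<xi> has_vector_derivative \<phi> t) (at t within {a..b}))"
    by blast
qed

text \<open>The indefinite integral is monotone with equal end values, hence constant, and its derivative is
  \<open>\<phi>\<close> at all but finitely many points.\<close>

lemma nonneg_has_integral_0_imp_zero:
  fixes \<phi> :: "real \<Rightarrow> real"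
  assumes pc: "piecewise_continuous_on a b \<phi>" and nonneg: "\<And>\<sigma>. \<sigma> \<in> {a..b} \<Longrightarrow> 0 \<le> \<phi> \<sigma>"
    and zero: "(\<phi> has_integral 0) {a..b}"
  shows "\<exists>K. finite K \<and> (\<forall>\<sigma>\<in>{a..b} - K. \<phi> \<sigma> = 0)"
proof -
  have int: "\<phi> integrable_on {a..t}" if "t \<in> {a..b}" for t
    using that by (intro piecewise_continuous_on_integrable piecewise_continuous_on_subset[OF pc]) auto
  have y0: "(\<phi> has_integral (0 - 0)) {a..t}" if t: "t \<in> {a..b}" for t
  proof -
    have "integral {a..t} \<phi> \<le> integral {a..b} \<phi>"
      using t nonneg int by (intro integral_subset_le) auto
    moreover have "0 \<le> integral {a..t} \<phi>"
      using t nonneg int by (intro integral_nonneg) auto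
    ultimately have "integral {a..t} \<phi> = 0" using integral_unique[OF zero] by simp
    then show ?thesis using int[OF t] by (simp add: has_integral_integral)
  qed
  obtain K where K: "finite K"
    "\<forall>t\<in>{a..b} - K. ((\<lambda>_. 0) has_vector_derivative \<phi> t) (at t within {a..b})"
    using has_vector_derivative_of_has_integral(2)[OF pc y0] by blast
  show ?thesis
  proof (intro exI[of _ "insert a (insert b K)"] conjI ballI)
    fix t assume t: "t \<in> {a..b} - insert a (insert b K)"
    then have "((\<lambda>_. 0) has_vector_derivative \<phi> t) (at t within {a..b})" using K(2) by blast
    then have "((\<lambda>_. 0::real) has_vector_derivative \<phi> t) (at t)"
      using t by (simp add: at_within_Icc_at)
    then show "\<phi> t = 0"
      using vector_derivative_unique_at has_vector_derivative_const by blast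
  qed (use K in simp)
qed

section \<open>Global solutions of Lipschitz equations\<close>

text \<open>For \<open>\<psi> t = exp (- \<kappa> * (t - a)) *\<^sub>R \<xi> t\<close> the Picard operator is a contraction in the supremum norm on the
  whole interval when \<open>\<kappa>\<close> is large, so that no patching of short intervals is needed. Integrability of
  \<open>G\<close> along continuous curves is a hypothesis in place of continuity in time, because the controls
  jump.\<close>

lemma picard_lindeloef_global:
  fixes G :: "real \<Rightarrow> 'a::banach \<Rightarrow> 'a"
  assumes ab: "a \<le> b" and L: "0 \<le> L"
    and lip: "\<And>\<sigma> x y. \<sigma> \<in> {a..b} \<Longrightarrow> norm (G \<sigma> x - G \<sigma> y) \<le> L * norm (x - y)"
    and int: "\<And>\<xi>. continuous_on {a..b} \<xi> \<Longrightarrow> (\<lambda>\<sigma>. G \<sigma> (\<xi> \<sigma>)) integrable_on {a..b}"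
  obtains \<xi> where "continuous_on {a..b} \<xi>"
    "\<And>t. t \<in> {a..b} \<Longrightarrow> ((\<lambda>\<sigma>. G \<sigma> (\<xi> \<sigma>)) has_integral (\<xi> t - x\<^sub>0)) {a..t}"
proof -
  \<comment> \<open>Any \<open>\<kappa> \<ge> 2 * L\<close> makes the contraction factor \<open>L / \<kappa>\<close> at most \<open>1/2\<close>; the summand \<open>1\<close>
    keeps \<open>\<kappa>\<close> positive when \<open>L = 0\<close>.\<close>
  define \<kappa> where "\<kappa> = 2 * L + 1"
  have \<kappa>: "0 < \<kappa>" "L / \<kappa> \<le> 1/2" using L by (auto simp: \<kappa>_def field_simps)
  define lift where "lift \<psi> \<sigma> = exp (\<kappa> * (\<sigma> - a)) *\<^sub>R apply_bcontfun \<psi> \<sigma>" for \<psi> :: "real \<Rightarrow>\<^sub>C 'a" and \<sigma>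
  \<comment> \<open>Functions on \<open>{a..b}\<close> are extended constantly to the line, to live in the space of
    bounded continuous functions.\<close>
  define cl where "cl t = max a (min b t)" for t :: real
  have cl: "cl t \<in> {a..b}" "t \<in> {a..b} \<Longrightarrow> cl t = t" for t
    using ab by (auto simp: cl_def)
  define T where "T \<psi> t = exp (- \<kappa> * (t - a)) *\<^sub>R (x\<^sub>0 + integral {a..t} (\<lambda>\<sigma>. G \<sigma> (lift \<psi> \<sigma>)))"
    for \<psi> :: "real \<Rightarrow>\<^sub>C 'a" and t
  have lift_cont: "continuous_on S (lift \<psi>)" for \<psi> S
    unfolding lift_def by (intro continuous_intros continuous_on_apply_bcontfun)
  note lift_int = int[OF lift_cont]
  have T_cont: "continuous_on {a..b} (T \<psi>)" for \<psi>
    unfolding T_def by (intro continuous_intros indefinite_integral_continuous_1 lift_int)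
  have T_bcont: "(\<lambda>t. T \<psi> (cl t)) \<in> bcontfun" for \<psi>
    unfolding bcontfun_def
  proof safe
    show "continuous_on UNIV (\<lambda>t. T \<psi> (cl t))"
      by (rule continuous_on_compose2[OF T_cont]) (use cl in \<open>auto simp: cl_def intro!: continuous_intros\<close>)
    have "bounded (T \<psi> ` {a..b})"
      by (intro compact_imp_bounded compact_continuous_image T_cont) simp
    then show "bounded (range (\<lambda>t. T \<psi> (cl t)))"
      by (rule bounded_subset) (use cl in auto)
  qed
  define TT where "TT \<psi> = Bcontfun (\<lambda>t. T \<psi> (cl t))" for \<psi>
  have TT: "apply_bcontfun (TT \<psi>) t = T \<psi> (cl t)" for \<psi> t
    unfolding TT_def using Bcontfun_inverse[OF T_bcont] by metis
  have contr: "dist (TT \<psi>) (TT \<phi>) \<le> 1/2 * dist \<psi> \<phi>" for \<psi> \<phi>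
  proof (rule dist_bound)
    fix t0 define t where "t = cl t0"
    have t: "t \<in> {a..b}" using cl by (simp add: t_def)
    define D where "D = dist \<psi> \<phi>"
    have sub: "(\<lambda>\<sigma>. G \<sigma> (lift \<psi> \<sigma>)) integrable_on {a..t}" for \<psi>
      using integrable_on_subinterval[OF lift_int] t by auto
    have he: "((\<lambda>\<sigma>. L * (exp (\<kappa> * (\<sigma> - a)) * D)) has_integral
        (L / \<kappa> * D * exp (\<kappa> * (t - a)) - L / \<kappa> * D * exp (\<kappa> * (a - a)))) {a..t}"
      by (rule fundamental_theorem_of_calculus)
        (use t \<kappa> in \<open>auto simp: has_real_derivative_iff_has_vector_derivative[symmetric]
            intro!: derivative_eq_intros\<close>)
    have "norm (integral {a..t} (\<lambda>\<sigma>. G \<sigma> (lift \<psi> \<sigma>)) - integral {a..t} (\<lambda>\<sigma>. G \<sigma> (lift \<phi> \<sigma>)))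
        = norm (integral {a..t} (\<lambda>\<sigma>. G \<sigma> (lift \<psi> \<sigma>) - G \<sigma> (lift \<phi> \<sigma>)))"
      by (simp add: integral_diff sub)
    also have "\<dots> \<le> integral {a..t} (\<lambda>\<sigma>. L * (exp (\<kappa> * (\<sigma> - a)) * D))"
    proof (rule Henstock_Kurzweil_Integration.integral_norm_bound_integral)
      show "(\<lambda>\<sigma>. G \<sigma> (lift \<psi> \<sigma>) - G \<sigma> (lift \<phi> \<sigma>)) integrable_on {a..t}"
        by (intro integrable_diff sub)
      show "(\<lambda>\<sigma>. L * (exp (\<kappa> * (\<sigma> - a)) * D)) integrable_on {a..t}" using he by blast
      fix \<sigma> assume \<sigma>: "\<sigma> \<in> {a..t}"
      have "norm (G \<sigma> (lift \<psi> \<sigma>) - G \<sigma> (lift \<phi> \<sigma>)) \<le> L * norm (lift \<psi> \<sigma> - lift \<phi> \<sigma>)"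
        using lip \<sigma> t by simp
      also have "norm (lift \<psi> \<sigma> - lift \<phi> \<sigma>) = exp (\<kappa> * (\<sigma> - a)) * dist (apply_bcontfun \<psi> \<sigma>) (apply_bcontfun \<phi> \<sigma>)"
        by (simp add: lift_def scaleR_diff_right[symmetric] dist_norm)
      also have "\<dots> \<le> exp (\<kappa> * (\<sigma> - a)) * D"
        unfolding D_def by (intro mult_left_mono dist_bounded) simp
      finally show "norm (G \<sigma> (lift \<psi> \<sigma>) - G \<sigma> (lift \<phi> \<sigma>)) \<le> L * (exp (\<kappa> * (\<sigma> - a)) * D)"
        using L by (simp add: mult_left_mono)
    qed
    also have "\<dots> = L / \<kappa> * D * exp (\<kappa> * (t - a)) - L / \<kappa> * D"
      using integral_unique[OF he] by simp
    also have "\<dots> \<le> L / \<kappa> * (D * exp (\<kappa> * (t - a)))"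
    proof -
      have "0 \<le> L / \<kappa> * D" using L \<kappa> by (simp add: D_def)
      then show ?thesis by (simp add: mult.assoc)
    qed
    also have "\<dots> \<le> 1/2 * (D * exp (\<kappa> * (t - a)))"
      using \<kappa> by (intro mult_right_mono) (auto simp: D_def)
    finally have *: "norm (integral {a..t} (\<lambda>\<sigma>. G \<sigma> (lift \<psi> \<sigma>)) - integral {a..t} (\<lambda>\<sigma>. G \<sigma> (lift \<phi> \<sigma>)))
        \<le> 1/2 * (D * exp (\<kappa> * (t - a)))" .
    have "dist (T \<psi> t) (T \<phi> t) = exp (- \<kappa> * (t - a)) *
        norm (integral {a..t} (\<lambda>\<sigma>. G \<sigma> (lift \<psi> \<sigma>)) - integral {a..t} (\<lambda>\<sigma>. G \<sigma> (lift \<phi> \<sigma>)))"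
      by (simp add: T_def dist_norm scaleR_diff_right[symmetric])
    also have "\<dots> \<le> exp (- \<kappa> * (t - a)) * (1/2 * (D * exp (\<kappa> * (t - a))))"
      by (intro mult_left_mono *) simp
    also have "\<dots> = 1/2 * D * (exp (- \<kappa> * (t - a)) * exp (\<kappa> * (t - a)))" by simp
    also have "\<dots> = 1/2 * D" by (simp add: exp_add[symmetric])
    finally show "dist (apply_bcontfun (TT \<psi>) t0) (apply_bcontfun (TT \<phi>) t0) \<le> 1/2 * dist \<psi> \<phi>"
      by (simp add: TT t_def D_def)
  qed
  obtain \<psi> where \<psi>: "TT \<psi> = \<psi>"
    using banach_fix_type[of "1/2" TT] contr by auto
  have fixed: "lift \<psi> t = x\<^sub>0 + integral {a..t} (\<lambda>\<sigma>. G \<sigma> (lift \<psi> \<sigma>))" if "t \<in> {a..b}" for t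
  proof -
    have "apply_bcontfun \<psi> t = T \<psi> t" using TT[of \<psi> t] \<psi> cl(2)[OF that] by simp
    then show ?thesis unfolding lift_def[of \<psi> t] T_def by (simp add: exp_minus)
  qed
  show ?thesis
  proof
    show "continuous_on {a..b} (lift \<psi>)" by (rule lift_cont)
    fix t assume t: "t \<in> {a..b}"
    have "(\<lambda>\<sigma>. G \<sigma> (lift \<psi> \<sigma>)) integrable_on {a..t}"
      using integrable_on_subinterval[OF lift_int] t by auto
    then show "((\<lambda>\<sigma>. G \<sigma> (lift \<psi> \<sigma>)) has_integral (lift \<psi> t - x\<^sub>0)) {a..t}"
      using fixed[OF t] by (simp add: has_integral_integral)
  qed
qed

section \<open>Continuously differentiable maps\<close>

lemma continuously_differentiable_onI:
  assumes "\<And>z. z \<in> D \<Longrightarrow> (f has_derivative blinfun_apply (f' z)) (at z within D)"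
    and "continuous_on D f'"
  shows "continuously_differentiable_on f D"
  using assms unfolding continuously_differentiable_on_def by blast

lemma continuously_differentiable_onE:
  assumes "continuously_differentiable_on f D"
  obtains f' where "\<And>z. z \<in> D \<Longrightarrow> (f has_derivative blinfun_apply (f' z)) (at z within D)"
    and "continuous_on D f'"
  using assms unfolding continuously_differentiable_on_def by blast

lemma continuously_differentiable_imp_continuous_on:
  "continuously_differentiable_on f D \<Longrightarrow> continuous_on D f"
  by (meson continuously_differentiable_onE has_derivative_continuous_on)

lemma continuously_differentiable_on_bounded_linear:
  assumes "bounded_linear f"
  shows "continuously_differentiable_on f D"
proof (rule continuously_differentiable_onI[where f' = "\<lambda>_. Blinfun f"])
  show "(f has_derivative blinfun_apply (Blinfun f)) (at z within D)" for z
    using assms by (simp add: bounded_linear_Blinfun_apply bounded_linear_imp_has_derivative)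
qed simp

lemma continuously_differentiable_on_const: "continuously_differentiable_on (\<lambda>_. c) D"
  by (rule continuously_differentiable_onI[where f' = "\<lambda>_. 0"]) (auto simp: zero_blinfun.rep_eq)

lemma continuously_differentiable_on_compose:
  assumes g: "continuously_differentiable_on g T" and f: "continuously_differentiable_on f D"
    and sub: "f ` D \<subseteq> T"
  shows "continuously_differentiable_on (\<lambda>z. g (f z)) D"
proof -
  obtain f' where f': "\<And>z. z \<in> D \<Longrightarrow> (f has_derivative blinfun_apply (f' z)) (at z within D)"
    "continuous_on D f'"
    by (rule continuously_differentiable_onE[OF f]) blast
  obtain g' where g': "\<And>z. z \<in> T \<Longrightarrow> (g has_derivative blinfun_apply (g' z)) (at z within T)"
    "continuous_on T g'"
    by (rule continuously_differentiable_onE[OF g]) blast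
  show ?thesis
  proof (rule continuously_differentiable_onI)
    show "((\<lambda>z. g (f z)) has_derivative blinfun_apply (g' (f z) o\<^sub>L f' z)) (at z within D)"
      if z: "z \<in> D" for z
    proof -
      have "(g has_derivative blinfun_apply (g' (f z))) (at (f z) within f ` D)"
        using g'(1)[of "f z"] sub z by (auto intro: has_derivative_subset)
      from has_derivative_in_compose[OF f'(1)[OF z] this] show ?thesis
        by (simp add: blinfun_compose.rep_eq o_def)
    qed
    show "continuous_on D (\<lambda>z. g' (f z) o\<^sub>L f' z)"
      using f'(2) continuous_on_compose2[OF g'(2) continuously_differentiable_imp_continuous_on[OF f] sub]
      by (intro continuous_intros)
  qed
qed

lemma continuously_differentiable_on_add:
  assumes f: "continuously_differentiable_on f D" and g: "continuously_differentiable_on g D"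
  shows "continuously_differentiable_on (\<lambda>z. f z + g z) D"
proof -
  obtain f' where f': "\<And>z. z \<in> D \<Longrightarrow> (f has_derivative blinfun_apply (f' z)) (at z within D)"
    "continuous_on D f'"
    by (rule continuously_differentiable_onE[OF f]) blast
  obtain g' where g': "\<And>z. z \<in> D \<Longrightarrow> (g has_derivative blinfun_apply (g' z)) (at z within D)"
    "continuous_on D g'"
    by (rule continuously_differentiable_onE[OF g]) blast
  show ?thesis
  proof (rule continuously_differentiable_onI)
    show "((\<lambda>z. f z + g z) has_derivative blinfun_apply (f' z + g' z)) (at z within D)"
      if "z \<in> D" for z
      using has_derivative_add[OF f'(1)[OF that] g'(1)[OF that]]
      by (simp add: plus_blinfun.rep_eq)
  qed (intro continuous_intros f' g')
qed

lemma continuously_differentiable_on_sum: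
  assumes "\<And>i. i \<in> I \<Longrightarrow> continuously_differentiable_on (f i) D"
  shows "continuously_differentiable_on (\<lambda>z. \<Sum>i\<in>I. f i z) D"
  using assms
  by (induction I rule: infinite_finite_induct)
    (auto intro: continuously_differentiable_on_const continuously_differentiable_on_add)

lemma continuously_differentiable_on_linear_compose:
  assumes "bounded_linear l" "continuously_differentiable_on f D"
  shows "continuously_differentiable_on (\<lambda>z. l (f z)) D"
  by (rule continuously_differentiable_on_compose[OF
        continuously_differentiable_on_bounded_linear[OF assms(1), of UNIV] assms(2)]) simp

lemma continuously_differentiable_on_scaleR:
  fixes f :: "'a::real_normed_vector \<Rightarrow> real"
  assumes f: "continuously_differentiable_on f D" and g: "continuously_differentiable_on g D"
  shows "continuously_differentiable_on (\<lambda>z. f z *\<^sub>R g z) D"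
proof -
  obtain f' where f': "\<And>z. z \<in> D \<Longrightarrow> (f has_derivative blinfun_apply (f' z)) (at z within D)"
    "continuous_on D f'"
    by (rule continuously_differentiable_onE[OF f]) blast
  obtain g' where g': "\<And>z. z \<in> D \<Longrightarrow> (g has_derivative blinfun_apply (g' z)) (at z within D)"
    "continuous_on D g'"
    by (rule continuously_differentiable_onE[OF g]) blast
  show ?thesis
  proof (rule continuously_differentiable_onI)
    show "((\<lambda>z. f z *\<^sub>R g z) has_derivative
        blinfun_apply ((blinfun_scaleR_right (f z) o\<^sub>L g' z) + (blinfun_scaleR_left (g z) o\<^sub>L f' z)))
        (at z within D)" if "z \<in> D" for z
      using has_derivative_scaleR[OF f'(1)[OF that] g'(1)[OF that]]
      by (simp add: plus_blinfun.rep_eq blinfun_compose.rep_eq o_def)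
    show "continuous_on D (\<lambda>z. (blinfun_scaleR_right (f z) o\<^sub>L g' z) + (blinfun_scaleR_left (g z) o\<^sub>L f' z))"
      by (intro continuous_intros f' g' bounded_linear.continuous_on[OF bounded_linear_blinfun_scaleR_right]
          bounded_linear.continuous_on[OF bounded_linear_blinfun_scaleR_left]
          continuously_differentiable_imp_continuous_on f g)
  qed
qed

lemma C1_differentiable_imp_continuously_differentiable_on:
  fixes q :: "real \<Rightarrow> 'a::real_normed_vector"
  assumes "q C1_differentiable_on UNIV"
  shows "continuously_differentiable_on q UNIV"
proof -
  obtain D where D: "\<And>x. (q has_vector_derivative D x) (at x)" "continuous_on UNIV D"
    using assms by (auto simp: C1_differentiable_on_def)
  show ?thesis
  proof (rule continuously_differentiable_onI)
    show "(q has_derivative blinfun_apply (blinfun_scaleR_left (D x))) (at x)" for x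
      using D(1)[of x] by (simp add: has_vector_derivative_def)
    show "continuous_on UNIV (\<lambda>x. blinfun_scaleR_left (D x))"
      by (intro bounded_linear.continuous_on[OF bounded_linear_blinfun_scaleR_left] D)
  qed
qed

lemma C1_lipschitz_on_compact:
  assumes der: "\<And>z. z \<in> D \<Longrightarrow> (F has_derivative blinfun_apply (F' z)) (at z within D)"
    and cont: "continuous_on D F'" and K: "compact K" "convex K" "K \<subseteq> D"
  shows "\<exists>L\<ge>0. (\<forall>z\<in>K. norm (F' z) \<le> L) \<and> (\<forall>y\<in>K. \<forall>z\<in>K. norm (F y - F z) \<le> L * norm (y - z))"
proof -
  have "bounded (F' ` K)"
    using K continuous_on_subset[OF cont] by (intro compact_imp_bounded compact_continuous_image) auto
  then obtain L where L: "0 < L" "\<And>z. z \<in> K \<Longrightarrow> norm (F' z) \<le> L"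
    unfolding bounded_pos by blast
  have "norm (F y - F z) \<le> L * norm (y - z)" if "y \<in> K" "z \<in> K" for y z
  proof (rule differentiable_bound[OF K(2) _ _ that])
    show "(F has_derivative blinfun_apply (F' x)) (at x within K)" if "x \<in> K" for x
      using der K(3) that by (blast intro: has_derivative_subset)
    show "onorm (blinfun_apply (F' x)) \<le> L" if "x \<in> K" for x
      using L(2)[OF that] by (simp add: norm_blinfun.rep_eq)
  qed
  then show ?thesis using L by (intro exI[of _ L]) auto
qed

text \<open>The derivative is uniformly continuous on \<open>K\<close>; the mean value inequality on the convex set
  \<open>K \<inter> ball z \<delta>\<close> turns this into a bound for the linearization error.\<close>

lemma C1_uniform_linearization:
  fixes F :: "'a::real_normed_vector \<Rightarrow> 'b::real_normed_vector"
  assumes der: "\<And>z. z \<in> D \<Longrightarrow> (F has_derivative blinfun_apply (F' z)) (at z within D)"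
    and cont: "continuous_on D F'" and K: "compact K" "convex K" "K \<subseteq> D" and \<epsilon>: "0 < \<epsilon>"
  shows "\<exists>\<delta>>0. \<forall>y\<in>K. \<forall>z\<in>K. norm (y - z) < \<delta> \<longrightarrow>
       norm (F y - F z - F' z (y - z)) \<le> \<epsilon> * norm (y - z)"
proof -
  have "uniformly_continuous_on K F'"
    using K continuous_on_subset[OF cont] compact_uniformly_continuous by blast
  then obtain \<delta> where \<delta>: "0 < \<delta>" "\<And>y z. y \<in> K \<Longrightarrow> z \<in> K \<Longrightarrow> dist y z < \<delta> \<Longrightarrow> dist (F' y) (F' z) < \<epsilon>"
    using \<epsilon> unfolding uniformly_continuous_on_def by metis
  have "norm (F y - F z - F' z (y - z)) \<le> \<epsilon> * norm (y - z)"
    if yz: "y \<in> K" "z \<in> K" "norm (y - z) < \<delta>" for y z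
  proof -
    have conv: "convex (K \<inter> ball z \<delta>)" using K by (intro convex_Int) auto
    have mem: "y \<in> K \<inter> ball z \<delta>" "z \<in> K \<inter> ball z \<delta>"
      using yz \<delta>(1) by (auto simp: dist_norm norm_minus_commute)
    have "norm (F y - F z - blinfun_apply (F' z) (y - z)) \<le> norm (y - z) * \<epsilon>"
    proof (rule differentiable_bound_linearization[where S = "K \<inter> ball z \<delta>"])
      show "z + t *\<^sub>R (y - z) \<in> K \<inter> ball z \<delta>" if "t \<in> {0..1}" for t
      proof -
        have "z + t *\<^sub>R (y - z) = (1 - t) *\<^sub>R z + t *\<^sub>R y" by (simp add: algebra_simps)
        then show ?thesis using convexD_alt[OF conv mem(2,1), of t] that by simp
      qed
      show "(F has_derivative blinfun_apply (F' x)) (at x within K \<inter> ball z \<delta>)"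
        if "x \<in> K \<inter> ball z \<delta>" for x
        using der K(3) that by (blast intro: has_derivative_subset)
      show "onorm (blinfun_apply (F' x) - blinfun_apply (F' z)) \<le> \<epsilon>" if "x \<in> K \<inter> ball z \<delta>" for x
      proof -
        have "norm (F' x - F' z) \<le> \<epsilon>"
          using \<delta>(2)[of x z] that mem by (auto simp: dist_norm dist_commute norm_minus_commute)
        moreover have "blinfun_apply (F' x - F' z) = blinfun_apply (F' x) - blinfun_apply (F' z)"
          by (auto simp: minus_blinfun.rep_eq)
        ultimately show ?thesis by (metis norm_blinfun.rep_eq)
      qed
    qed (use mem in auto)
    then show ?thesis by (simp add: mult.commute)
  qed
  then show ?thesis using \<delta>(1) by blast
qed

section \<open>Dependence of solutions on initial values and controls\<close>

text \<open>The set \<open>Z\<close> is the region in which the right-hand side is differentiable; solutions have to stay in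
  it. It need not be open, which admits solutions that run along its boundary.\<close>

definition integral_solution ::
  "('a \<times> 'w \<Rightarrow> 'a) \<Rightarrow> 'a set \<Rightarrow> real \<Rightarrow> real \<Rightarrow> (real \<Rightarrow> 'w) \<Rightarrow> 'a::euclidean_space \<Rightarrow> (real \<Rightarrow> 'a) \<Rightarrow> bool" where
  "integral_solution F Z a b w x \<xi> \<longleftrightarrow> continuous_on {a..b} \<xi> \<and>
     (\<forall>t\<in>{a..b}. \<xi> t \<in> Z \<and> ((\<lambda>\<sigma>. F (\<xi> \<sigma>, w \<sigma>)) has_integral (\<xi> t - x)) {a..t})"

text \<open>Intersecting \<open>Z\<close> with balls around the origin instead of taking a neighbourhood of the curve keeps the
  set convex, as the mean value inequality requires.\<close>

lemma compact_convex_tube: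
  fixes \<xi> :: "real \<Rightarrow> 'a::euclidean_space" and w :: "real \<Rightarrow> 'w::euclidean_space"
  assumes Z: "closed Z" "convex Z" and \<xi>: "bounded (\<xi> ` {a..b})" and w: "bounded (w ` {a..b})"
  shows "\<exists>K. compact K \<and> convex K \<and> K \<subseteq> Z \<times> UNIV \<and>
    (\<forall>\<sigma>\<in>{a..b}. \<forall>z\<in>Z. \<forall>v. norm (z - \<xi> \<sigma>) \<le> 1 \<longrightarrow> norm (v - w \<sigma>) \<le> 1 \<longrightarrow> (z, v) \<in> K)"
proof -
  obtain M where M: "\<And>\<sigma>. \<sigma> \<in> {a..b} \<Longrightarrow> norm (\<xi> \<sigma>) \<le> M"
    using \<xi> unfolding bounded_iff by blast
  obtain M' where M': "\<And>\<sigma>. \<sigma> \<in> {a..b} \<Longrightarrow> norm (w \<sigma>) \<le> M'"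
    using w unfolding bounded_iff by blast
  let ?K = "(Z \<inter> cball 0 (M + 1)) \<times> (cball 0 (M' + 1) :: 'w set)"
  show ?thesis
  proof (intro exI[of _ ?K] conjI ballI allI impI)
    show "compact ?K" using Z by (intro compact_Times closed_Int_compact compact_cball)
    show "convex ?K" using Z by (intro convex_Times convex_Int) auto
    fix \<sigma> z v assume *: "\<sigma> \<in> {a..b}" "z \<in> Z" "norm (z - \<xi> \<sigma>) \<le> 1" "norm (v - w \<sigma>) \<le> 1"
    show "(z, v) \<in> ?K"
      using * M[OF *(1)] M'[OF *(1)] norm_triangle_sub[of z "\<xi> \<sigma>"] norm_triangle_sub[of v "w \<sigma>"]
      by auto
  qed auto
qed

context
  fixes F :: "'a::euclidean_space \<times> 'w::euclidean_space \<Rightarrow> 'a" and F' Z and a b :: real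
    and w\<^sub>0 :: "real \<Rightarrow> 'w" and x\<^sub>0 :: 'a and \<xi> :: "real \<Rightarrow> 'a"
  assumes Z: "closed Z" "convex Z"
    and der: "\<And>z. z \<in> Z \<times> UNIV \<Longrightarrow> (F has_derivative blinfun_apply (F' z)) (at z within Z \<times> UNIV)"
    and cont: "continuous_on (Z \<times> UNIV) F'"
    and ab: "a \<le> b" and w\<^sub>0: "piecewise_continuous_on a b w\<^sub>0"
    and \<xi>: "integral_solution F Z a b w\<^sub>0 x\<^sub>0 \<xi>"
begin

lemma reference_tube:
  "\<exists>K. compact K \<and> convex K \<and> K \<subseteq> Z \<times> UNIV \<and>
    (\<forall>\<sigma>\<in>{a..b}. \<forall>z\<in>Z. \<forall>v. norm (z - \<xi> \<sigma>) \<le> 1 \<longrightarrow> norm (v - w\<^sub>0 \<sigma>) \<le> 1 \<longrightarrow> (z, v) \<in> K)"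
proof (rule compact_convex_tube[OF Z])
  show "bounded (\<xi> ` {a..b})"
    using \<xi> by (auto simp: integral_solution_def intro: compact_imp_bounded compact_continuous_image)
  show "bounded (w\<^sub>0 ` {a..b})" using w\<^sub>0 by (simp add: piecewise_continuous_on_def)
qed

lemma integral_solutions_close:
  "\<exists>C>0. \<exists>\<delta>>0. \<forall>w x \<eta> m. integral_solution F Z a b w x \<eta> \<longrightarrow> norm (x - x\<^sub>0) \<le> m \<longrightarrow>
       (\<forall>\<sigma>\<in>{a..b}. norm (w \<sigma> - w\<^sub>0 \<sigma>) \<le> m) \<longrightarrow> m \<le> \<delta> \<longrightarrow>
       (\<forall>t\<in>{a..b}. norm (\<eta> t - \<xi> t) \<le> C * m)"
proof -
  obtain K where K: "compact K" "convex K" "K \<subseteq> Z \<times> UNIV"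
    and tube: "\<forall>\<sigma>\<in>{a..b}. \<forall>z\<in>Z. \<forall>v. norm (z - \<xi> \<sigma>) \<le> 1 \<longrightarrow> norm (v - w\<^sub>0 \<sigma>) \<le> 1 \<longrightarrow> (z, v) \<in> K"
    using reference_tube by blast
  obtain L where L: "0 \<le> L" "\<forall>y\<in>K. \<forall>z\<in>K. norm (F y - F z) \<le> L * norm (y - z)"
    using C1_lipschitz_on_compact[OF der cont K(1,2,3)] by blast
  define C where "C = (1 + L * (b - a)) * exp (L * (b - a))"
  have "1 * 1 \<le> C" unfolding C_def using L ab by (intro mult_mono) auto
  then have C: "1 \<le> C" by simp
  define \<delta> where "\<delta> = 1 / (2 * C)"
  have \<delta>: "0 < \<delta>" "C * \<delta> < 1" "\<delta> < 1" using C by (auto simp: \<delta>_def field_simps)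
  show ?thesis
  proof (rule exI[of _ C], intro exI[of _ \<delta>] conjI allI impI ballI)
    fix w x \<eta> m t
    assume \<eta>: "integral_solution F Z a b w x \<eta>" and x: "norm (x - x\<^sub>0) \<le> m"
      and w: "\<forall>\<sigma>\<in>{a..b}. norm (w \<sigma> - w\<^sub>0 \<sigma>) \<le> m" and m: "m \<le> \<delta>" and t: "t \<in> {a..b}"
    have m0: "0 \<le> m" using x norm_ge_zero[of "x - x\<^sub>0"] by linarith
    have cont_diff: "continuous_on {a..b} (\<lambda>s. \<eta> s - \<xi> s)"
      using \<eta> \<xi> by (auto simp: integral_solution_def intro!: continuous_intros)
    \<comment> \<open>Gronwall bounds the deviation as long as the perturbed solution stays in the tube of
      radius 1, where \<open>F\<close> is Lipschitz; the bound itself then shows that it never leaves it.\<close>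
    have est: "norm (\<eta> c - \<xi> c) \<le> C * m"
      if c: "c \<in> {a..b}" and le: "\<And>s. s \<in> {a..c} \<Longrightarrow> norm (\<eta> s - \<xi> s) \<le> 1" for c
    proof -
      have "norm (\<eta> c - \<xi> c) \<le> (m + L * m * (c - a)) * exp (L * (c - a))"
      proof (rule gronwall_has_integral[where e\<^sub>0 = "x - x\<^sub>0" and a = a and b = c])
        show "continuous_on {a..c} (\<lambda>s. \<eta> s - \<xi> s)"
          using cont_diff by (rule continuous_on_subset) (use c in auto)
        show "((\<lambda>\<sigma>. F (\<eta> \<sigma>, w \<sigma>) - F (\<xi> \<sigma>, w\<^sub>0 \<sigma>)) has_integral (\<eta> s - \<xi> s - (x - x\<^sub>0))) {a..s}"
          if "s \<in> {a..c}" for s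
        proof -
          have "((\<lambda>\<sigma>. F (\<eta> \<sigma>, w \<sigma>) - F (\<xi> \<sigma>, w\<^sub>0 \<sigma>)) has_integral ((\<eta> s - x) - (\<xi> s - x\<^sub>0))) {a..s}"
            using \<eta> \<xi> that c by (intro has_integral_diff) (auto simp: integral_solution_def)
          then show ?thesis by (simp add: algebra_simps)
        qed
        show "norm (F (\<eta> \<sigma>, w \<sigma>) - F (\<xi> \<sigma>, w\<^sub>0 \<sigma>)) \<le> L * norm (\<eta> \<sigma> - \<xi> \<sigma>) + L * m"
          if \<sigma>: "\<sigma> \<in> {a..c}" for \<sigma>
        proof -
          have \<sigma>': "\<sigma> \<in> {a..b}" using \<sigma> c by auto
          have "(\<eta> \<sigma>, w \<sigma>) \<in> K" "(\<xi> \<sigma>, w\<^sub>0 \<sigma>) \<in> K"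
            using \<eta> \<xi> \<sigma>' le[OF \<sigma>] bspec[OF w \<sigma>'] m \<delta> by (auto intro!: tube[rule_format, OF \<sigma>'] simp: integral_solution_def)
          then have "norm (F (\<eta> \<sigma>, w \<sigma>) - F (\<xi> \<sigma>, w\<^sub>0 \<sigma>)) \<le> L * norm ((\<eta> \<sigma>, w \<sigma>) - (\<xi> \<sigma>, w\<^sub>0 \<sigma>))"
            using L(2) by blast
          also have "\<dots> \<le> L * (norm (\<eta> \<sigma> - \<xi> \<sigma>) + m)"
            using norm_Pair_le[of "\<eta> \<sigma> - \<xi> \<sigma>" "w \<sigma> - w\<^sub>0 \<sigma>"] bspec[OF w \<sigma>'] L
            by (intro mult_left_mono) auto
          finally show ?thesis by (simp add: algebra_simps)
        qed
      qed (use L m0 x c in auto)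
      also have "\<dots> \<le> (m + L * m * (b - a)) * exp (L * (b - a))"
        using c L m0 by (intro mult_mono add_left_mono mult_left_mono) (auto intro: mult_left_mono)
      also have "\<dots> = C * m" by (simp add: C_def algebra_simps)
      finally show ?thesis .
    qed
    have "C * m \<le> C * \<delta>" using m C by (intro mult_left_mono) auto
    then have Cm: "C * m < 1" using \<delta> by simp
    have "\<eta> a = x" "\<xi> a = x\<^sub>0"
      using \<eta> \<xi> by (auto simp: integral_solution_def intro: has_integral_start[OF ab])
    then have start: "norm (\<eta> a - \<xi> a) < 1" using x m \<delta> by simp
    have "norm (\<eta> s - \<xi> s) < 1" if "s \<in> {a..b}" for s
    proof (rule continuity_argument_less[of a b "\<lambda>s. norm (\<eta> s - \<xi> s)" 1, OF _ start _ that])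
      show "continuous_on {a..b} (\<lambda>s. norm (\<eta> s - \<xi> s))" by (rule continuous_on_norm[OF cont_diff])
      show "norm (\<eta> c - \<xi> c) < 1" if "c \<in> {a..b}" "\<And>s. s \<in> {a..c} \<Longrightarrow> norm (\<eta> s - \<xi> s) \<le> 1" for c
        using est[OF that] Cm by simp
    qed
    then show "norm (\<eta> t - \<xi> t) \<le> C * m" using t by (intro est) (auto intro: less_imp_le)
  qed (use C \<delta> in auto)
qed

text \<open>The remainder \<open>\<eta> - \<xi> - \<zeta>\<close> starts at \<open>0\<close> and solves the linearized equation up to an error that is
  small relative to \<open>m\<close>, because \<open>\<eta>\<close> is within a multiple of \<open>m\<close> of \<open>\<xi>\<close>. Gronwall's inequality transfers the
  smallness to the remainder.\<close>

lemma integral_solutions_first_order: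
  assumes \<epsilon>: "0 < \<epsilon>"
  shows "\<exists>\<delta>>0. \<forall>w x \<eta> m \<zeta>. integral_solution F Z a b w x \<eta> \<longrightarrow> norm (x - x\<^sub>0) \<le> m \<longrightarrow>
       (\<forall>\<sigma>\<in>{a..b}. norm (w \<sigma> - w\<^sub>0 \<sigma>) \<le> m) \<longrightarrow> m \<le> \<delta> \<longrightarrow> continuous_on {a..b} \<zeta> \<longrightarrow>
       (\<forall>t\<in>{a..b}. ((\<lambda>\<sigma>. F' (\<xi> \<sigma>, w\<^sub>0 \<sigma>) (\<zeta> \<sigma>, w \<sigma> - w\<^sub>0 \<sigma>)) has_integral
          (\<zeta> t - (x - x\<^sub>0))) {a..t}) \<longrightarrow>
       (\<forall>t\<in>{a..b}. norm (\<eta> t - \<xi> t - \<zeta> t) \<le> \<epsilon> * m)"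
proof -
  obtain K where K: "compact K" "convex K" "K \<subseteq> Z \<times> UNIV"
    and tube: "\<forall>\<sigma>\<in>{a..b}. \<forall>z\<in>Z. \<forall>v. norm (z - \<xi> \<sigma>) \<le> 1 \<longrightarrow> norm (v - w\<^sub>0 \<sigma>) \<le> 1 \<longrightarrow> (z, v) \<in> K"
    using reference_tube by blast
  obtain L where L: "0 \<le> L" "\<forall>z\<in>K. norm (F' z) \<le> L"
    using C1_lipschitz_on_compact[OF der cont K(1,2,3)] by blast
  obtain C \<delta>\<^sub>0 where C: "0 < C" "0 < \<delta>\<^sub>0"
    and close: "\<forall>w x \<eta> m. integral_solution F Z a b w x \<eta> \<longrightarrow> norm (x - x\<^sub>0) \<le> m \<longrightarrow>
       (\<forall>\<sigma>\<in>{a..b}. norm (w \<sigma> - w\<^sub>0 \<sigma>) \<le> m) \<longrightarrow> m \<le> \<delta>\<^sub>0 \<longrightarrow>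
       (\<forall>t\<in>{a..b}. norm (\<eta> t - \<xi> t) \<le> C * m)"
    using integral_solutions_close by blast
  define Q where "Q = (C + 1) * (b - a) * exp (L * (b - a)) + 1"
  have Q: "0 < Q" using C ab unfolding Q_def by (intro add_nonneg_pos) auto
  define \<epsilon>' where "\<epsilon>' = \<epsilon> / Q"
  have \<epsilon>': "0 < \<epsilon>'" "\<epsilon>' * Q = \<epsilon>" using \<epsilon> Q by (auto simp: \<epsilon>'_def)
  obtain \<delta>\<^sub>1 where \<delta>\<^sub>1: "0 < \<delta>\<^sub>1" "\<forall>y\<in>K. \<forall>z\<in>K. norm (y - z) < \<delta>\<^sub>1 \<longrightarrow>
       norm (F y - F z - F' z (y - z)) \<le> \<epsilon>' * norm (y - z)"
    using C1_uniform_linearization[OF der cont K(1,2,3) \<epsilon>'(1)] by blast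
  define \<delta> where "\<delta> = Min {\<delta>\<^sub>0, 1, 1 / C, \<delta>\<^sub>1 / (2 * (C + 1))}"
  have \<delta>: "0 < \<delta>" "\<delta> \<le> \<delta>\<^sub>0" "\<delta> \<le> 1" "\<delta> \<le> 1 / C" "\<delta> \<le> \<delta>\<^sub>1 / (2 * (C + 1))"
    using C \<delta>\<^sub>1 by (auto simp: \<delta>_def)
  have \<delta>C: "C * \<delta> \<le> 1" "(C + 1) * \<delta> < \<delta>\<^sub>1"
    using \<delta>(4,5) C \<delta>\<^sub>1 by (auto simp: field_simps)
  show ?thesis
  proof (intro exI[of _ \<delta>] conjI allI impI ballI)
    show "0 < \<delta>" by (rule \<delta>(1))
    fix w x \<eta> m \<zeta> t
    assume \<eta>: "integral_solution F Z a b w x \<eta>" and x: "norm (x - x\<^sub>0) \<le> m"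
      and w: "\<forall>\<sigma>\<in>{a..b}. norm (w \<sigma> - w\<^sub>0 \<sigma>) \<le> m" and m: "m \<le> \<delta>"
      and \<zeta>: "continuous_on {a..b} \<zeta>"
        "\<forall>t\<in>{a..b}.
          ((\<lambda>\<sigma>. F' (\<xi> \<sigma>, w\<^sub>0 \<sigma>) (\<zeta> \<sigma>, w \<sigma> - w\<^sub>0 \<sigma>)) has_integral (\<zeta> t - (x - x\<^sub>0))) {a..t}"
      and t: "t \<in> {a..b}"
    have m0: "0 \<le> m" using x norm_ge_zero[of "x - x\<^sub>0"] by linarith
    have cl: "norm (\<eta> s - \<xi> s) \<le> C * m" if "s \<in> {a..b}" for s
      using close \<eta> x w that m order_trans[OF m \<delta>(2)] by blast
    have "C * m \<le> C * \<delta>" "(C + 1) * m \<le> (C + 1) * \<delta>" using m C by (auto intro: mult_left_mono)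
    then have Cm: "C * m \<le> 1" "(C + 1) * m < \<delta>\<^sub>1" using \<delta>C by auto
    have "norm (\<eta> t - \<xi> t - \<zeta> t) \<le> (0 + \<epsilon>' * ((C + 1) * m) * (b - a)) * exp (L * (b - a))"
    proof (rule gronwall_has_integral[where e\<^sub>0 = 0])
      show "continuous_on {a..b} (\<lambda>s. \<eta> s - \<xi> s - \<zeta> s)"
        using \<eta> \<xi> \<zeta> by (auto simp: integral_solution_def intro!: continuous_intros)
      let ?\<phi> = "\<lambda>\<sigma>. F (\<eta> \<sigma>, w \<sigma>) - F (\<xi> \<sigma>, w\<^sub>0 \<sigma>) - F' (\<xi> \<sigma>, w\<^sub>0 \<sigma>) (\<zeta> \<sigma>, w \<sigma> - w\<^sub>0 \<sigma>)"
      show "(?\<phi> has_integral (\<eta> s - \<xi> s - \<zeta> s - 0)) {a..s}" if "s \<in> {a..b}" for s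
      proof -
        have "(?\<phi> has_integral ((\<eta> s - x) - (\<xi> s - x\<^sub>0) - (\<zeta> s - (x - x\<^sub>0)))) {a..s}"
          using \<eta> \<xi> that \<zeta>(2) by (intro has_integral_diff) (auto simp: integral_solution_def)
        then show ?thesis by (simp add: algebra_simps)
      qed
      show "norm (?\<phi> \<sigma>) \<le> L * norm (\<eta> \<sigma> - \<xi> \<sigma> - \<zeta> \<sigma>) + \<epsilon>' * ((C + 1) * m)"
        if \<sigma>: "\<sigma> \<in> {a..b}" for \<sigma>
      proof -
        let ?y = "(\<eta> \<sigma>, w \<sigma>)" and ?z = "(\<xi> \<sigma>, w\<^sub>0 \<sigma>)"
        have K': "?y \<in> K" "?z \<in> K"
          using \<eta> \<xi> \<sigma> cl[OF \<sigma>] bspec[OF w \<sigma>] m \<delta> Cm by (auto intro!: tube[rule_format, OF \<sigma>] simp: integral_solution_def)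
        have d: "norm (?y - ?z) \<le> (C + 1) * m"
          using norm_Pair_le[of "\<eta> \<sigma> - \<xi> \<sigma>" "w \<sigma> - w\<^sub>0 \<sigma>"] bspec[OF w \<sigma>] cl[OF \<sigma>]
          by (simp add: algebra_simps)
        \<comment> \<open>The remainder solves the linear equation up to the linearization error of \<open>F\<close>.\<close>
        have eq: "?\<phi> \<sigma> = (F ?y - F ?z - F' ?z (?y - ?z)) + F' ?z (\<eta> \<sigma> - \<xi> \<sigma> - \<zeta> \<sigma>, 0)"
        proof -
          have "(\<eta> \<sigma> - \<xi> \<sigma> - \<zeta> \<sigma>, 0) = (?y - ?z) - (\<zeta> \<sigma>, w \<sigma> - w\<^sub>0 \<sigma>)" by simp
          then have "F' ?z (\<eta> \<sigma> - \<xi> \<sigma> - \<zeta> \<sigma>, 0) = F' ?z (?y - ?z) - F' ?z (\<zeta> \<sigma>, w \<sigma> - w\<^sub>0 \<sigma>)"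
            by (simp only: blinfun.diff_right)
          moreover have "p - q - r = (p - q - s) + (s - r)" for p q r s :: 'a by simp
          ultimately show ?thesis by (simp only:)
        qed
        have "norm (F ?y - F ?z - F' ?z (?y - ?z)) \<le> \<epsilon>' * norm (?y - ?z)"
          using \<delta>\<^sub>1(2)[rule_format, OF K'] d Cm by simp
        also have "\<dots> \<le> \<epsilon>' * ((C + 1) * m)" using d \<epsilon>' by (intro mult_left_mono) auto
        finally have 1: "norm (F ?y - F ?z - F' ?z (?y - ?z)) \<le> \<epsilon>' * ((C + 1) * m)" .
        have "norm (F' ?z (\<eta> \<sigma> - \<xi> \<sigma> - \<zeta> \<sigma>, 0)) \<le> norm (F' ?z) * norm (\<eta> \<sigma> - \<xi> \<sigma> - \<zeta> \<sigma>, 0::'w)"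
          by (rule norm_blinfun)
        also have "\<dots> \<le> L * norm (\<eta> \<sigma> - \<xi> \<sigma> - \<zeta> \<sigma>)"
          using bspec[OF L(2) K'(2)] by (simp add: norm_Pair mult_right_mono)
        finally have 2: "norm (F' ?z (\<eta> \<sigma> - \<xi> \<sigma> - \<zeta> \<sigma>, 0)) \<le> L * norm (\<eta> \<sigma> - \<xi> \<sigma> - \<zeta> \<sigma>)" .
        show ?thesis unfolding eq by (rule norm_triangle_le) (use 1 2 in linarith)
      qed
    qed (use L m0 C \<epsilon>' t in auto)
    also have "\<dots> = \<epsilon>' * (Q - 1) * m" by (simp add: Q_def algebra_simps)
    also have "\<dots> \<le> \<epsilon>' * Q * m" using \<epsilon>'(1) m0 by (intro mult_right_mono mult_left_mono) auto
    finally show "norm (\<eta> t - \<xi> t - \<zeta> t) \<le> \<epsilon> * m" using \<epsilon>'(2) by simp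
  qed
qed

lemma variational_equation_solvable:
  assumes v: "piecewise_continuous_on a b v"
  shows "\<exists>\<zeta>. continuous_on {a..b} \<zeta> \<and> (\<forall>t\<in>{a..b}.
    ((\<lambda>\<sigma>. F' (\<xi> \<sigma>, w\<^sub>0 \<sigma>) (\<zeta> \<sigma>, v \<sigma>)) has_integral (\<zeta> t - z\<^sub>0)) {a..t})"
proof -
  obtain K where K: "compact K" "convex K" "K \<subseteq> Z \<times> UNIV"
    and tube: "\<forall>\<sigma>\<in>{a..b}. \<forall>z\<in>Z. \<forall>v. norm (z - \<xi> \<sigma>) \<le> 1 \<longrightarrow> norm (v - w\<^sub>0 \<sigma>) \<le> 1 \<longrightarrow> (z, v) \<in> K"
    using reference_tube by blast
  obtain L where L: "0 \<le> L" "\<forall>z\<in>K. norm (F' z) \<le> L"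
    using C1_lipschitz_on_compact[OF der cont K(1,2,3)] by blast
  show ?thesis
  proof (rule picard_lindeloef_global[OF ab L(1), where x\<^sub>0 = z\<^sub>0
        and G = "\<lambda>\<sigma> z. F' (\<xi> \<sigma>, w\<^sub>0 \<sigma>) (z, v \<sigma>)"])
    fix \<sigma> and y z :: 'a assume \<sigma>: "\<sigma> \<in> {a..b}"
    have "(\<xi> \<sigma>, w\<^sub>0 \<sigma>) \<in> K" using \<xi> \<sigma> by (auto intro!: tube[rule_format, OF \<sigma>] simp: integral_solution_def)
    then have "norm (F' (\<xi> \<sigma>, w\<^sub>0 \<sigma>)) * norm (y - z, 0::'w) \<le> L * norm (y - z)"
      using L(2) by (simp add: norm_Pair mult_right_mono)
    then show "norm (F' (\<xi> \<sigma>, w\<^sub>0 \<sigma>) (y, v \<sigma>) - F' (\<xi> \<sigma>, w\<^sub>0 \<sigma>) (z, v \<sigma>)) \<le> L * norm (y - z)"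
      using norm_blinfun[of "F' (\<xi> \<sigma>, w\<^sub>0 \<sigma>)" "(y - z, 0)"] by (simp add: blinfun.diff_right[symmetric])
  next
    fix \<zeta> :: "real \<Rightarrow> 'a" assume \<zeta>: "continuous_on {a..b} \<zeta>"
    have "piecewise_continuous_on a b (\<lambda>\<sigma>. (\<lambda>(z, u). F' z u) ((\<xi> \<sigma>, w\<^sub>0 \<sigma>), (\<zeta> \<sigma>, v \<sigma>)))"
    proof (rule piecewise_continuous_on_compose[where T = "(Z \<times> UNIV) \<times> UNIV"])
      show "continuous_on ((Z \<times> UNIV) \<times> UNIV) (\<lambda>(z, u). blinfun_apply (F' z) u)"
        unfolding split_beta
        by (intro continuous_intros continuous_on_compose2[OF cont]) auto
      show "closed ((Z \<times> (UNIV :: 'w set)) \<times> (UNIV :: ('a \<times> 'w) set))"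
        using Z by (intro closed_Times) auto
      show "piecewise_continuous_on a b (\<lambda>\<sigma>. ((\<xi> \<sigma>, w\<^sub>0 \<sigma>), (\<zeta> \<sigma>, v \<sigma>)))"
        using \<xi> by (intro piecewise_continuous_on_Pair w\<^sub>0 v continuous_imp_piecewise_continuous_on \<zeta>)
          (auto simp: integral_solution_def)
    qed (use \<xi> in \<open>auto simp: integral_solution_def\<close>)
    then show "(\<lambda>\<sigma>. F' (\<xi> \<sigma>, w\<^sub>0 \<sigma>) (\<zeta> \<sigma>, v \<sigma>)) integrable_on {a..b}"
      by (intro piecewise_continuous_on_integrable) simp
  qed blast
qed

end

text \<open>The initial value and the control depend linearly on a parameter \<open>p\<close>. The set \<open>P\<close> of parameters is
  arbitrary: existence of the solutions for its members is all that differentiability within \<open>P\<close>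
  requires. The derivative comes with the variational equation that determines it, from which its
  rows can be read off.\<close>

theorem endpoint_has_derivative:
  fixes F :: "'a::euclidean_space \<times> 'w::euclidean_space \<Rightarrow> 'a" and c :: "real \<Rightarrow> 'p::euclidean_space \<Rightarrow> 'w"
    and A :: "'p \<Rightarrow> 'a"
  assumes Z: "closed Z" "convex Z"
    and der: "\<And>z. z \<in> Z \<times> UNIV \<Longrightarrow> (F has_derivative blinfun_apply (F' z)) (at z within Z \<times> UNIV)"
    and cont: "continuous_on (Z \<times> UNIV) F'"
    and ab: "a \<le> b"
    and A: "bounded_linear A"
    and c: "\<And>\<sigma>. linear (c \<sigma>)" "\<And>p. piecewise_continuous_on a b (\<lambda>\<sigma>. c \<sigma> p)"
    and sol: "\<And>p. p \<in> P \<Longrightarrow> integral_solution F Z a b (\<lambda>\<sigma>. c \<sigma> p) (A p) (\<xi> p)" and p: "p \<in> P"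
  obtains D \<zeta> where "((\<lambda>p. \<xi> p b) has_derivative D) (at p within P)"
    "\<And>h t. t \<in> {a..b} \<Longrightarrow> ((\<lambda>\<sigma>. F' (\<xi> p \<sigma>, c \<sigma> p) (\<zeta> h \<sigma>, c \<sigma> h)) has_integral (\<zeta> h t - A h)) {a..t}"
    "\<And>h. \<zeta> h b = D h"
proof -
  note ctxt = Z der cont ab c(2) sol[OF p]
  have "\<exists>\<zeta>. continuous_on {a..b} \<zeta> \<and> (\<forall>t\<in>{a..b}.
      ((\<lambda>\<sigma>. F' (\<xi> p \<sigma>, c \<sigma> p) (\<zeta> \<sigma>, c \<sigma> h)) has_integral (\<zeta> t - A h)) {a..t})" for h
    by (rule variational_equation_solvable[OF ctxt c(2)]) assumption
  then have "\<exists>\<zeta>. \<forall>h. continuous_on {a..b} (\<zeta> h) \<and> (\<forall>t\<in>{a..b}.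
      ((\<lambda>\<sigma>. F' (\<xi> p \<sigma>, c \<sigma> p) (\<zeta> h \<sigma>, c \<sigma> h)) has_integral (\<zeta> h t - A h)) {a..t})"
    by (intro choice allI)
  then obtain \<zeta>\<^sub>0 where \<zeta>\<^sub>0: "\<And>h. continuous_on {a..b} (\<zeta>\<^sub>0 h)"
    "\<And>h t. t \<in> {a..b} \<Longrightarrow>
      ((\<lambda>\<sigma>. F' (\<xi> p \<sigma>, c \<sigma> p) (\<zeta>\<^sub>0 h \<sigma>, c \<sigma> h)) has_integral (\<zeta>\<^sub>0 h t - A h)) {a..t}"
    by blast
  \<comment> \<open>Superposition of the solutions for the basis directions makes the dependence on \<open>h\<close> linear
    by construction.\<close>
  define \<zeta> where "\<zeta> h t = (\<Sum>i\<in>Basis. (h \<bullet> i) *\<^sub>R \<zeta>\<^sub>0 i t)" for h t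
  have \<zeta>_cont: "continuous_on {a..b} (\<zeta> h)" for h
    unfolding \<zeta>_def by (intro continuous_intros \<zeta>\<^sub>0)
  have expand: "g h = (\<Sum>i\<in>Basis. (h \<bullet> i) *\<^sub>R g i)" if "linear g" for g :: "'p \<Rightarrow> 'b::real_vector" and h
  proof -
    interpret linear g by fact
    have "g h = g (\<Sum>i\<in>Basis. (h \<bullet> i) *\<^sub>R i)" by (simp add: euclidean_representation)
    then show ?thesis by (simp add: sum scale)
  qed
  have \<zeta>_int: "((\<lambda>\<sigma>. F' (\<xi> p \<sigma>, c \<sigma> p) (\<zeta> h \<sigma>, c \<sigma> h)) has_integral (\<zeta> h t - A h)) {a..t}"
    if t: "t \<in> {a..b}" for h t
  proof -
    have "((\<lambda>\<sigma>. \<Sum>i\<in>Basis. (h \<bullet> i) *\<^sub>R F' (\<xi> p \<sigma>, c \<sigma> p) (\<zeta>\<^sub>0 i \<sigma>, c \<sigma> i)) has_integral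
        (\<Sum>i\<in>Basis. (h \<bullet> i) *\<^sub>R (\<zeta>\<^sub>0 i t - A i))) {a..t}"
      by (intro has_integral_sum has_integral_cmul \<zeta>\<^sub>0 t) simp
    moreover have "(\<Sum>i\<in>Basis. (h \<bullet> i) *\<^sub>R (\<zeta>\<^sub>0 i t - A i)) = \<zeta> h t - A h"
      using expand[of A h] A by (simp add: \<zeta>_def scaleR_diff_right sum_subtractf bounded_linear.linear)
    moreover have "(\<Sum>i\<in>Basis. (h \<bullet> i) *\<^sub>R F' (\<xi> p \<sigma>, c \<sigma> p) (\<zeta>\<^sub>0 i \<sigma>, c \<sigma> i)) =
        F' (\<xi> p \<sigma>, c \<sigma> p) (\<zeta> h \<sigma>, c \<sigma> h)" for \<sigma>
    proof -
      have "(\<zeta> h \<sigma>, c \<sigma> h) = (\<Sum>i\<in>Basis. (h \<bullet> i) *\<^sub>R (\<zeta>\<^sub>0 i \<sigma>, c \<sigma> i))"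
        using expand[of "c \<sigma>" h] c(1) by (simp add: \<zeta>_def prod_eq_iff fst_sum snd_sum)
      then show ?thesis by (simp only: blinfun.sum_right blinfun.scaleR_right)
    qed
    ultimately show ?thesis by simp
  qed
  \<comment> \<open>Each basis direction gives a bounded control, so the linear dependence is uniformly bounded.\<close>
  obtain M where M: "\<And>i \<sigma>. \<sigma> \<in> {a..b} \<Longrightarrow> norm (c \<sigma> i) \<le> M i"
  proof -
    have "\<forall>i. \<exists>M. \<forall>\<sigma>\<in>{a..b}. norm (c \<sigma> i) \<le> M"
      using c(2) unfolding piecewise_continuous_on_def bounded_iff by blast
    then show ?thesis using that by metis
  qed
  define B where "B = sum M Basis"
  have B: "norm (c \<sigma> h) \<le> B * norm h" if \<sigma>: "\<sigma> \<in> {a..b}" for \<sigma> h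
  proof -
    have "norm (c \<sigma> h) \<le> (\<Sum>i\<in>Basis. norm ((h \<bullet> i) *\<^sub>R c \<sigma> i))"
      using expand[OF c(1), of \<sigma> h] by (simp only: norm_sum)
    also have "\<dots> \<le> (\<Sum>i\<in>Basis. norm h * M i)"
      using M[OF \<sigma>] by (intro sum_mono) (auto intro!: mult_mono Basis_le_norm)
    finally show ?thesis by (simp add: B_def sum_distrib_left mult.commute)
  qed
  define B' where "B' = max 1 (max B (onorm A))"
  have B': "1 \<le> B'" "B \<le> B'" "onorm A \<le> B'" by (auto simp: B'_def)
  have "((\<lambda>p. \<xi> p b) has_derivative (\<lambda>h. \<zeta> h b)) (at p within P)"
    unfolding has_derivative_within_alt
  proof (intro conjI allI impI)
    have "linear (\<lambda>h. \<zeta> h b)"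
      by (intro linearI) (simp_all add: \<zeta>_def inner_add_left algebra_simps sum.distrib scaleR_sum_right)
    then show "bounded_linear (\<lambda>h. \<zeta> h b)" by (simp add: linear_conv_bounded_linear)
    fix e :: real assume "0 < e"
    then have "0 < e / B'" using B' by auto
    obtain \<delta> where \<delta>: "0 < \<delta>"
      "\<forall>w x \<eta> m \<zeta>. integral_solution F Z a b w x \<eta> \<longrightarrow> norm (x - A p) \<le> m \<longrightarrow>
       (\<forall>\<sigma>\<in>{a..b}. norm (w \<sigma> - c \<sigma> p) \<le> m) \<longrightarrow> m \<le> \<delta> \<longrightarrow> continuous_on {a..b} \<zeta> \<longrightarrow>
       (\<forall>t\<in>{a..b}. ((\<lambda>\<sigma>. F' (\<xi> p \<sigma>, c \<sigma> p) (\<zeta> \<sigma>, w \<sigma> - c \<sigma> p)) has_integral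
          (\<zeta> t - (x - A p))) {a..t}) \<longrightarrow>
       (\<forall>t\<in>{a..b}. norm (\<eta> t - \<xi> p t - \<zeta> t) \<le> e / B' * m)"
      using integral_solutions_first_order[OF ctxt \<open>0 < e / B'\<close>] by blast
    show "\<exists>d>0. \<forall>y\<in>P. norm (y - p) < d \<longrightarrow> norm (\<xi> y b - \<xi> p b - \<zeta> (y - p) b) \<le> e * norm (y - p)"
    proof (intro exI[of _ "\<delta> / B'"] conjI ballI impI)
      show "0 < \<delta> / B'" using \<delta> B' by auto
      fix y assume y: "y \<in> P" "norm (y - p) < \<delta> / B'"
      have cd: "c \<sigma> y - c \<sigma> p = c \<sigma> (y - p)" for \<sigma> using c(1) by (simp add: linear_diff)
      have Ad: "A y - A p = A (y - p)" using A by (simp add: linear_diff bounded_linear.linear)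
      have "norm (\<xi> y b - \<xi> p b - \<zeta> (y - p) b) \<le> e / B' * (B' * norm (y - p))"
      proof (rule \<delta>(2)[rule_format, OF sol[OF y(1)] _ _ _ \<zeta>_cont])
        show "norm (A y - A p) \<le> B' * norm (y - p)"
          unfolding Ad using onorm[OF A, of "y - p"] B' by (meson mult_right_mono norm_ge_zero order_trans)
        show "norm (c \<sigma> y - c \<sigma> p) \<le> B' * norm (y - p)" if "\<sigma> \<in> {a..b}" for \<sigma>
          unfolding cd using B[OF that, of "y - p"] B' by (meson mult_right_mono norm_ge_zero order_trans)
        show "B' * norm (y - p) \<le> \<delta>" using y(2) B' by (simp add: field_simps)
        show "((\<lambda>\<sigma>. F' (\<xi> p \<sigma>, c \<sigma> p) (\<zeta> (y - p) \<sigma>, c \<sigma> y - c \<sigma> p)) has_integral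
            (\<zeta> (y - p) t - (A y - A p))) {a..t}" if "t \<in> {a..b}" for t
          unfolding cd Ad by (rule \<zeta>_int[OF that])
      qed (use ab in auto)
      then show "norm (\<xi> y b - \<xi> p b - \<zeta> (y - p) b) \<le> e * norm (y - p)" using B' by simp
    qed
  qed
  then show ?thesis using \<zeta>_int by (rule that) (assumption, rule refl)
qed

section \<open>Piecewise polynomials\<close>

text \<open>By induction on the set of breakpoints, an interior breakpoint splitting the interval in two.\<close>

lemma piecewise_polynomial_bounded:
  assumes "finite K" "\<And>\<alpha> \<beta>. {\<alpha><..<\<beta>} \<subseteq> {c..d} - K \<Longrightarrow> \<exists>P. \<forall>\<sigma>\<in>{\<alpha><..<\<beta>}. \<phi> \<sigma> = poly P (\<sigma>::real)"
  shows "bounded (\<phi> ` {c..d} :: real set)"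
  using assms
proof (induction K arbitrary: c d rule: finite_induct)
  case empty
  have "{c<..<d} \<subseteq> {c..d} - {}" by auto
  then obtain P where P: "\<forall>\<sigma>\<in>{c<..<d}. \<phi> \<sigma> = poly P \<sigma>" using empty by blast
  have "bounded (poly P ` {c..d})"
    by (intro compact_imp_bounded compact_continuous_image continuous_intros) auto
  then have "bounded (poly P ` {c..d} \<union> {\<phi> c, \<phi> d})" by simp
  then show ?case
  proof (rule bounded_subset)
    show "\<phi> ` {c..d} \<subseteq> poly P ` {c..d} \<union> {\<phi> c, \<phi> d}"
    proof
      fix y assume "y \<in> \<phi> ` {c..d}"
      then obtain \<sigma> where \<sigma>: "\<sigma> \<in> {c..d}" "y = \<phi> \<sigma>" by blast
      show "y \<in> poly P ` {c..d} \<union> {\<phi> c, \<phi> d}"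
      proof (cases "\<sigma> \<in> {c<..<d}")
        case True
        then show ?thesis using P \<sigma> by auto
      next
        case False
        then have "\<sigma> = c \<or> \<sigma> = d" using \<sigma> by auto
        then show ?thesis using \<sigma> by auto
      qed
    qed
  qed
next
  case (insert k K)
  show ?case
  proof (cases "k \<in> {c..d}")
    case True
    have "bounded (\<phi> ` {c..k})"
    proof (rule insert.IH)
      fix \<alpha> \<beta> assume *: "{\<alpha><..<\<beta>} \<subseteq> {c..k} - K"
      have "{\<alpha><..<\<beta>} \<subseteq> interior {c..k}" using * by (intro interior_maximal) auto
      then show "\<exists>P. \<forall>\<sigma>\<in>{\<alpha><..<\<beta>}. \<phi> \<sigma> = poly P \<sigma>"
        using True * by (intro insert.prems) auto
    qed
    moreover have "bounded (\<phi> ` {k..d})"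
    proof (rule insert.IH)
      fix \<alpha> \<beta> assume *: "{\<alpha><..<\<beta>} \<subseteq> {k..d} - K"
      have "{\<alpha><..<\<beta>} \<subseteq> interior {k..d}" using * by (intro interior_maximal) auto
      then show "\<exists>P. \<forall>\<sigma>\<in>{\<alpha><..<\<beta>}. \<phi> \<sigma> = poly P \<sigma>"
        using True * by (intro insert.prems) auto
    qed
    ultimately have "bounded (\<phi> ` {c..k} \<union> \<phi> ` {k..d})" by simp
    moreover have "{c..d} = {c..k} \<union> {k..d}" using True by auto
    ultimately show ?thesis by (simp add: image_Un)
  next
    case False
    then have "{c..d} - insert k K = {c..d} - K" by auto
    then show ?thesis using insert.prems by (intro insert.IH) auto
  qed
qed

lemma piecewise_polynomial_imp_piecewise_continuous:
  assumes "piecewise_polynomial_on {a..b} \<phi>"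
  shows "piecewise_continuous_on a b \<phi>"
proof -
  obtain K where K: "finite K"
    "\<And>\<alpha> \<beta>. {\<alpha><..<\<beta>} \<subseteq> {a..b} - K \<Longrightarrow> \<exists>P. \<forall>\<sigma>\<in>{\<alpha><..<\<beta>}. \<phi> \<sigma> = poly P \<sigma>"
    using assms unfolding piecewise_polynomial_on_def by blast
  let ?K = "insert a (insert b K)"
  have "continuous_on ({a..b} - ?K) \<phi>"
  proof (intro continuous_at_imp_continuous_on ballI)
    fix \<sigma> assume \<sigma>: "\<sigma> \<in> {a..b} - ?K"
    have "open ({a<..<b} - K)" using K(1) by (intro open_Diff finite_imp_closed) auto
    moreover have "\<sigma> \<in> {a<..<b} - K" using \<sigma> by auto
    ultimately obtain e where e: "0 < e" "ball \<sigma> e \<subseteq> {a<..<b} - K"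
      unfolding open_contains_ball by blast
    then have "{\<sigma> - e<..<\<sigma> + e} \<subseteq> {a..b} - K"
      by (force simp: ball_eq_greaterThanLessThan)
    then obtain P where P: "\<forall>s\<in>{\<sigma> - e<..<\<sigma> + e}. \<phi> s = poly P s" using K(2) by blast
    have "continuous_on {\<sigma> - e<..<\<sigma> + e} \<phi>"
      using continuous_on_poly[OF continuous_on_id] by (rule continuous_on_eq) (use P in auto)
    then show "isCont \<phi> \<sigma>"
      using e(1) by (simp add: continuous_on_eq_continuous_at)
  qed
  moreover have "bounded (\<phi> ` {a..b})"
    by (rule piecewise_polynomial_bounded[OF K(1)]) (rule K(2))
  moreover have "finite ?K" using K(1) by simp
  ultimately show ?thesis unfolding piecewise_continuous_on_def by blast
qed

text \<open>A nonzero polynomial has no root in a small interval to the right of \<open>a\<close>, hence keeps its sign there.\<close>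

lemma polynomial_sign_at_right:
  fixes P :: "real poly"
  obtains \<delta> \<epsilon> where "0 < \<delta>" "\<epsilon> = 1 \<or> \<epsilon> = - 1" "\<And>x. x \<in> {a<..<a + \<delta>} \<Longrightarrow> 0 \<le> \<epsilon> * poly P x"
proof (cases "P = 0")
  case True
  then show ?thesis using that[of 1 1] by simp
next
  case False
  then have "finite ({x. poly P x = 0} - {a})" by (simp add: poly_roots_finite)
  then obtain \<delta> where \<delta>: "0 < \<delta>" "\<And>x. x \<in> {x. poly P x = 0} - {a} \<Longrightarrow> \<delta> \<le> dist a x"
    using finite_set_avoid[of "{x. poly P x = 0} - {a}" a] by blast
  have nz: "poly P x \<noteq> 0" if "x \<in> {a<..<a + \<delta>}" for x
    using \<delta>(2)[of x] that by (auto simp: dist_real_def)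
  define m where "m = a + \<delta> / 2"
  have m: "m \<in> {a<..<a + \<delta>}" using \<delta>(1) by (auto simp: m_def)
  have same: "0 < poly P m * poly P x" if x: "x \<in> {a<..<a + \<delta>}" for x
  proof (rule ccontr)
    assume "\<not> 0 < poly P m * poly P x"
    then have *: "poly P m * poly P x < 0" using nz[OF m] nz[OF x] by (simp add: less_le)
    then have "m \<noteq> x" by (auto simp: not_less[symmetric])
    then consider "m < x" | "x < m" by linarith
    then obtain r where "min m x < r" "r < max m x" "poly P r = 0"
      using poly_IVT[of m x P] poly_IVT[of x m P] * by cases (auto simp: mult.commute)
    then show False using nz[of r] m x by (auto simp: min_def max_def split: if_splits)
  qed
  show ?thesis
  proof (rule that[OF \<delta>(1), of "sgn (poly P m)"])
    show "sgn (poly P m) = 1 \<or> sgn (poly P m) = - 1" using nz[OF m] by (simp add: sgn_if)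
    show "0 \<le> sgn (poly P m) * poly P x" if "x \<in> {a<..<a + \<delta>}" for x
      using same[OF that] by (auto simp: sgn_if zero_less_mult_iff)
  qed
qed

lemma piecewise_polynomial_sign_at_right:
  assumes pp: "piecewise_polynomial_on {a..b} \<phi>" and c: "a \<le> c" "c < b"
  obtains \<delta> \<epsilon> where "0 < \<delta>" "c + \<delta> \<le> b" "\<epsilon> = 1 \<or> \<epsilon> = - 1"
    "\<And>x. x \<in> {c<..<c + \<delta>} \<Longrightarrow> 0 \<le> \<epsilon> * \<phi> x"
proof -
  obtain K where K: "finite K"
    "\<And>\<alpha> \<beta>. {\<alpha><..<\<beta>} \<subseteq> {a..b} - K \<Longrightarrow> \<exists>P. \<forall>\<sigma>\<in>{\<alpha><..<\<beta>}. \<phi> \<sigma> = poly P \<sigma>"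
    using pp unfolding piecewise_polynomial_on_def by blast
  obtain r where r: "0 < r" "\<And>x. x \<in> K - {c} \<Longrightarrow> r \<le> dist c x"
    using finite_set_avoid[of "K - {c}" c] K(1) by auto
  define r' where "r' = min r (b - c)"
  have "{c<..<c + r'} \<subseteq> {a..b} - K"
    using r(2) c by (force simp: r'_def dist_real_def)
  then obtain P where P: "\<forall>\<sigma>\<in>{c<..<c + r'}. \<phi> \<sigma> = poly P \<sigma>" using K(2) by blast
  obtain \<delta> \<epsilon> where \<delta>: "0 < \<delta>" "\<epsilon> = 1 \<or> \<epsilon> = - 1" "\<And>x. x \<in> {c<..<c + \<delta>} \<Longrightarrow> 0 \<le> \<epsilon> * poly P x"
    using polynomial_sign_at_right by blast
  show ?thesis
  proof (rule that[of "min \<delta> r'" \<epsilon>])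
    show "0 < min \<delta> r'" using \<delta> r c by (simp add: r'_def)
    show "0 \<le> \<epsilon> * \<phi> x" if "x \<in> {c<..<c + min \<delta> r'}" for x
      using \<delta>(3)[of x] P that by auto
  qed (use \<delta>(2) in \<open>auto simp: r'_def\<close>)
qed

text \<open>Although \<open>\<phi>\<close> is positive at every point, it may tend to \<open>0\<close> at a discontinuity, in particular at \<open>a\<close>
  from the right, and then only one sign of \<open>d\<close> may be possible. Choosing \<open>d\<close> with the sign that \<open>\<psi>\<close> has
  near \<open>a\<close> works.\<close>

lemma perturbed_integral_nonneg:
  fixes \<phi> \<psi> :: "real \<Rightarrow> real"
  assumes ab: "l \<le> a" "a < b" "b \<le> r"
    and \<phi>: "piecewise_continuous_on a b \<phi>" "\<And>\<sigma>. \<sigma> \<in> {a..b} \<Longrightarrow> 0 < \<phi> \<sigma>"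
    and \<psi>: "piecewise_polynomial_on {l..r} \<psi>" and e: "0 < e"
  obtains d where "0 < \<bar>d\<bar>" "\<bar>d\<bar> < e" "\<And>t. t \<in> {a..b} \<Longrightarrow> 0 \<le> integral {a..t} (\<lambda>\<sigma>. \<phi> \<sigma> + d * \<psi> \<sigma>)"
proof -
  have ar: "a < r" using ab by simp
  obtain \<delta> \<epsilon> where \<delta>: "0 < \<delta>" "\<epsilon> = 1 \<or> \<epsilon> = - 1"
    and sign: "\<And>x. x \<in> {a<..<a + \<delta>} \<Longrightarrow> 0 \<le> \<epsilon> * \<psi> x"
    using piecewise_polynomial_sign_at_right[OF \<psi> ab(1) ar] by blast
  have \<psi>pc: "piecewise_continuous_on a b \<psi>"
    using piecewise_polynomial_imp_piecewise_continuous[OF \<psi>] ab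
    by (auto intro: piecewise_continuous_on_subset)
  have int: "\<phi> integrable_on {a..t}" "\<psi> integrable_on {a..t}" if "t \<in> {a..b}" for t
    using that \<phi>(1) \<psi>pc
    by (auto intro!: piecewise_continuous_on_integrable intro: piecewise_continuous_on_subset)
  obtain M where M: "0 < M" "\<And>\<sigma>. \<sigma> \<in> {a..b} \<Longrightarrow> \<bar>\<psi> \<sigma>\<bar> \<le> M"
    using \<psi>pc unfolding piecewise_continuous_on_def bounded_pos by auto
  \<comment> \<open>Up to \<open>m\<close> the perturbation has the right sign; after \<open>m\<close> the integral of \<open>\<phi>\<close> is at least \<open>c > 0\<close>
    and absorbs a small perturbation.\<close>
  define m where "m = min b (a + \<delta> / 2)"
  have m: "a < m" "m \<le> b" "m < a + \<delta>" using ab \<delta> by (auto simp: m_def)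
  have m': "m \<in> {a..b}" using m by simp
  define c where "c = integral {a..m} \<phi>"
  have mono: "integral {a..s} \<phi> \<le> integral {a..t} \<phi>" if "a \<le> s" "s \<le> t" "t \<le> b" for s t
    using that int \<phi>(2) by (intro integral_subset_le) (auto intro: less_imp_le)
  have "c \<noteq> 0"
  proof
    assume "c = 0"
    then have zero: "(\<phi> has_integral 0) {a..m}" using int[OF m'] by (simp add: c_def has_integral_integral)
    have pc: "piecewise_continuous_on a m \<phi>"
      by (rule piecewise_continuous_on_subset[OF \<phi>(1)]) (use m in auto)
    have nonneg: "0 \<le> \<phi> \<sigma>" if "\<sigma> \<in> {a..m}" for \<sigma> using \<phi>(2)[of \<sigma>] that m by simp
    obtain K where K: "finite K" "\<forall>\<sigma>\<in>{a..m} - K. \<phi> \<sigma> = 0"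
      using nonneg_has_integral_0_imp_zero[OF pc nonneg zero] by blast
    have "{a..m} \<subseteq> K"
    proof
      fix \<sigma> assume "\<sigma> \<in> {a..m}"
      then show "\<sigma> \<in> K" using bspec[OF K(2), of \<sigma>] \<phi>(2)[of \<sigma>] m by (cases "\<sigma> \<in> K") auto
    qed
    then show False using K(1) m(1) finite_subset infinite_Icc by blast
  qed
  moreover have "0 \<le> c" using mono[of a m] m by (simp add: c_def)
  ultimately have c: "0 < c" by simp
  define \<mu> where "\<mu> = min (e / 2) (c / (M * (b - a)))"
  have "0 < M * (b - a)" using M ab by simp
  then have \<mu>: "0 < \<mu>" "\<mu> < e" "\<mu> * M * (b - a) \<le> c"
    using e c M ab by (auto simp: \<mu>_def min_def field_simps)
  show ?thesis
  proof (rule that[of "\<epsilon> * \<mu>"])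
    show "0 < \<bar>\<epsilon> * \<mu>\<bar>" "\<bar>\<epsilon> * \<mu>\<bar> < e" using \<delta>(2) \<mu> by auto
    fix t assume t: "t \<in> {a..b}"
    have split: "integral {a..t} (\<lambda>\<sigma>. \<phi> \<sigma> + \<epsilon> * \<mu> * \<psi> \<sigma>) =
        integral {a..t} \<phi> + integral {a..t} (\<lambda>\<sigma>. \<epsilon> * \<mu> * \<psi> \<sigma>)"
      using int[OF t] by (intro integral_add integrable_on_mult_right) auto
    show "0 \<le> integral {a..t} (\<lambda>\<sigma>. \<phi> \<sigma> + \<epsilon> * \<mu> * \<psi> \<sigma>)"
    proof (cases "t \<le> m")
      case True
      have "0 \<le> integral {a..t} (\<lambda>\<sigma>. if \<sigma> = a then 0 else \<epsilon> * \<mu> * \<psi> \<sigma>)"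
      proof (rule integral_nonneg)
        show "(\<lambda>\<sigma>. if \<sigma> = a then 0 else \<epsilon> * \<mu> * \<psi> \<sigma>) integrable_on {a..t}"
          by (rule integrable_spike_finite[of "{a}" _ _ "\<lambda>\<sigma>. \<epsilon> * \<mu> * \<psi> \<sigma>"])
            (use int[OF t] in \<open>auto intro!: integrable_on_mult_right\<close>)
        fix \<sigma> assume \<sigma>: "\<sigma> \<in> {a..t}"
        show "0 \<le> (if \<sigma> = a then 0 else \<epsilon> * \<mu> * \<psi> \<sigma>)"
        proof (cases "\<sigma> = a")
          case False
          then have "0 \<le> \<mu> * (\<epsilon> * \<psi> \<sigma>)" using \<sigma> True m \<mu> sign[of \<sigma>] by (intro mult_nonneg_nonneg[of \<mu>]) auto
          then show ?thesis by (simp add: mult_ac)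
        qed simp
      qed
      also have "\<dots> = integral {a..t} (\<lambda>\<sigma>. \<epsilon> * \<mu> * \<psi> \<sigma>)"
        by (rule integral_spike[of "{a}"]) auto
      finally show ?thesis using split mono[of a t] t by simp
    next
      case False
      have "norm (integral {a..t} (\<lambda>\<sigma>. \<epsilon> * \<mu> * \<psi> \<sigma>)) \<le> integral {a..t} (\<lambda>\<sigma>. \<mu> * M)"
      proof (rule Henstock_Kurzweil_Integration.integral_norm_bound_integral)
        show "(\<lambda>\<sigma>. \<epsilon> * \<mu> * \<psi> \<sigma>) integrable_on {a..t}"
          using int[OF t] by (intro integrable_on_mult_right)
        show "norm (\<epsilon> * \<mu> * \<psi> \<sigma>) \<le> \<mu> * M" if "\<sigma> \<in> {a..t}" for \<sigma>
          using M(2)[of \<sigma>] that t \<mu> \<delta>(2) by (auto simp: abs_mult)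
      qed auto
      also have "\<dots> = \<mu> * M * (t - a)" using t by simp
      also have "\<dots> \<le> \<mu> * M * (b - a)" using t \<mu> M by (intro mult_left_mono) auto
      also have "\<dots> \<le> c" by (rule \<mu>(3))
      also have "c \<le> integral {a..t} \<phi>" unfolding c_def using False m t by (intro mono) auto
      finally show ?thesis using split by simp
    qed
  qed
qed

section \<open>Jacobians within a set\<close>

text \<open>The derivative within \<open>W\<close> is unique when \<open>W\<close> contains arbitrarily short steps from \<open>v\<close> along every
  coordinate axis. The Jacobian, which is defined by a choice among all derivatives, is then
  determined by any one of them.\<close>

lemma selector_mult_jacobian:
  fixes \<phi> :: "real^'m \<Rightarrow> real^'n" and E :: "real^'n^'k" and M :: "real^'m^'k"
  assumes der: "(\<phi> has_derivative \<phi>') (at v within W)"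
    and steps: "\<And>i e. i \<in> Basis \<Longrightarrow> 0 < e \<Longrightarrow> \<exists>d. 0 < \<bar>d\<bar> \<and> \<bar>d\<bar> < e \<and> v + d *\<^sub>R i \<in> W"
    and rows: "\<And>h. E *v \<phi>' h = M *v h"
  shows "\<phi> differentiable (at v within W)" "E ** jacobian \<phi> (at v within W) = M"
proof -
  show diff: "\<phi> differentiable (at v within W)" using der by (rule differentiableI)
  then have "(\<phi> has_derivative (\<lambda>h. jacobian \<phi> (at v within W) *v h)) (at v within W)"
    by (simp add: jacobian_works)
  then have "\<phi>' = (\<lambda>h. jacobian \<phi> (at v within W) *v h)"
    using frechet_derivative_unique_within[OF der _ steps] by blast
  then show "E ** jacobian \<phi> (at v within W) = M"
    using rows by (simp add: matrix_eq matrix_vector_mul_assoc[symmetric])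
qed

lemma coordinate_step_UNIV:
  fixes v i :: "'a::real_vector"
  shows "0 < e \<Longrightarrow> \<exists>d. 0 < \<bar>d\<bar> \<and> \<bar>d\<bar> < e \<and> v + d *\<^sub>R i \<in> UNIV"
  by (intro exI[of _ "e / 2"]) auto

section \<open>The augmented system\<close>

lemma E_x_nth: "(E_x *v z) $ i = z $ Inl i"
  and E_y_nth: "(E_y *v z) $ j = z $ Inr 0"
  and E_t_nth: "(E_t *v z) $ j = z $ Inr 1"
  by (simp_all add: E_x_def E_y_def E_t_def matrix_vector_mult_def if_distrib[of "\<lambda>a. a * _"]
      sum.delta cong: if_cong)

lemma aug_nth: "aug x y t $ Inl i = x $ i" "aug x y t $ Inr 0 = y" "aug x y t $ Inr 1 = t"
  by (simp_all add: aug_def)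

lemma vec_sum_2_eq_iff:
  fixes z z' :: "'b^('nx::finite + 2)"
  shows "z = z' \<longleftrightarrow> (\<forall>i. z $ Inl i = z' $ Inl i) \<and> z $ Inr 0 = z' $ Inr 0 \<and> z $ Inr 1 = z' $ Inr 1"
proof -
  have two: "(2::2) = 0" by simp
  have "(\<forall>j::2. P j) \<longleftrightarrow> P 0 \<and> P 1" for P
    unfolding forall_2 two by blast
  then show ?thesis
    by (simp add: vec_eq_iff split_sum_all)
qed

lemma aug_collect: "aug (E_x *v z) (z $ Inr 0) (z $ Inr 1) = z"
  by (simp add: vec_sum_2_eq_iff aug_nth E_x_nth)

lemma aug_split: "aug x y t = aug x 0 0 + y *\<^sub>R aug 0 1 0 + t *\<^sub>R aug 0 0 1"
  by (simp add: vec_sum_2_eq_iff aug_nth)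

lemma bounded_linear_aug: "bounded_linear (\<lambda>x. aug x 0 0)"
  by (simp add: linear_conv_bounded_linear[symmetric] linear_iff vec_sum_2_eq_iff aug_nth)

lemma aug_row_mult: "((\<chi> i. aug 0 c 0) :: real^('nx::finite + 2)^1) *v h = vec (c * h $ Inr 0)"
proof -
  have *: "aug 0 c 0 = c *\<^sub>R axis (Inr 0) (1::real)"
    by (simp add: vec_sum_2_eq_iff aug_nth axis_def)
  show ?thesis
    unfolding * by (simp add: vec_eq_iff matrix_vector_mul_component inner_axis')
qed

lemma E_y_mult: "E_y *v z = vec (z $ Inr 0)"
  by (simp add: vec_eq_iff E_y_nth)

abbreviation nonneg_time :: "(real^('nx::finite + 2)) set" where
  "nonneg_time \<equiv> {z. 0 \<le> z $ Inr 1}"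

lemma nonneg_time: "closed nonneg_time" "convex nonneg_time"
proof -
  have *: "nonneg_time = {z. 0 \<le> axis (Inr 1) 1 \<bullet> z}" by (simp add: inner_axis')
  show "closed nonneg_time" "convex nonneg_time"
    unfolding * by (auto intro: closed_halfspace_ge convex_halfspace_ge)
qed

lemma coordinate_step_nonneg_time:
  assumes z: "z \<in> nonneg_time" and i: "i \<in> Basis" and e: "0 < e"
  shows "\<exists>d. 0 < \<bar>d\<bar> \<and> \<bar>d\<bar> < e \<and> z + d *\<^sub>R i \<in> nonneg_time"
proof (intro exI[of _ "e / 2"] conjI)
  have "0 \<le> i $ Inr 1" using i by (auto simp: Basis_vec_def axis_def)
  then show "z + (e / 2) *\<^sub>R i \<in> nonneg_time" using z e by simp
qed (use e in auto)

lemma coordinate_step_nonneg_time_Times: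
  assumes z: "z \<in> nonneg_time \<times> UNIV" and i: "i \<in> Basis" and e: "0 < e"
  shows "\<exists>d. 0 < \<bar>d\<bar> \<and> \<bar>d\<bar> < e \<and> z + d *\<^sub>R i \<in> nonneg_time \<times> UNIV"
proof -
  have "fst i \<in> Basis \<or> fst i = 0" using i by (auto simp: Basis_prod_def)
  then obtain d where "0 < \<bar>d\<bar>" "\<bar>d\<bar> < e" "fst z + d *\<^sub>R fst i \<in> nonneg_time"
  proof
    assume "fst i \<in> Basis"
    then show ?thesis using coordinate_step_nonneg_time[of "fst z" "fst i" e] z e that by auto
  next
    assume "fst i = 0"
    then show ?thesis using that[of "e / 2"] z e by auto
  qed
  then show ?thesis by (intro exI[of _ d]) (auto simp: mem_Times_iff)
qed

text \<open>The point \<open>(t, x, u)\<close> at which the data are evaluated. It depends linearly on the pair of augmented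
  state and augmented control, so the chain rule applies to a linear inner map.\<close>

definition data_point :: "(real^('nx::finite + 2)) \<times> (real^'nu) \<times> real \<Rightarrow> real \<times> (real^'nx) \<times> (real^'nu)" where
  "data_point z = (fst z $ Inr 1, E_x *v fst z, fst (snd z))"

lemma bounded_linear_data_point: "bounded_linear data_point"
  unfolding data_point_def
  by (intro bounded_linear_Pair bounded_linear_compose[OF bounded_linear_vec_nth]
      bounded_linear_compose[OF matrix_vector_mul_bounded_linear] bounded_linear_fst
      bounded_linear_compose[OF bounded_linear_fst bounded_linear_snd])

lemma data_point_image: "data_point ` (nonneg_time \<times> UNIV) \<subseteq> {0..} \<times> UNIV"
  by (auto simp: data_point_def)

lemma aug_rhs_eq:
  "aug_rhs f \<Lambda> (fst z) (snd z) = snd (snd z) *\<^sub>R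
     (aug (f (data_point z)) 0 0 + \<Lambda> (data_point z) *\<^sub>R aug 0 1 0 + aug 0 0 1)"
proof -
  have "aug_rhs f \<Lambda> (fst z) (snd z) =
      snd (snd z) *\<^sub>R aug (f (data_point z)) (\<Lambda> (data_point z)) 1"
    by (simp add: aug_rhs_def data_point_def Let_def E_t_nth)
  then show ?thesis
    by (simp only: aug_split[of "f (data_point z)" "\<Lambda> (data_point z)" 1] scaleR_one)
qed

lemma aug_rhs_aug:
  "aug_rhs f \<Lambda> (aug x y t) w = snd w *\<^sub>R aug (f (t, x, fst w)) (\<Lambda> (t, x, fst w)) 1"
  by (simp add: aug_rhs_def Let_def selectors_aug)

lemma aug_rhs_C1:
  assumes f: "continuously_differentiable_on f ({0..} \<times> UNIV)"
    and \<Lambda>: "continuously_differentiable_on \<Lambda> ({0..} \<times> UNIV)"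
  shows "continuously_differentiable_on (\<lambda>z. aug_rhs f \<Lambda> (fst z) (snd z)) (nonneg_time \<times> UNIV)"
  unfolding aug_rhs_eq
  by (intro continuously_differentiable_on_scaleR continuously_differentiable_on_add
      continuously_differentiable_on_const
      continuously_differentiable_on_linear_compose[OF bounded_linear_aug]
      continuously_differentiable_on_compose[OF f _ data_point_image]
      continuously_differentiable_on_compose[OF \<Lambda> _ data_point_image]
      continuously_differentiable_on_bounded_linear[OF bounded_linear_data_point]
      continuously_differentiable_on_bounded_linear bounded_linear_compose[OF bounded_linear_snd bounded_linear_snd])

lemma is_trajectory_imp_integral_solution:
  assumes "is_trajectory F \<nu> a b x \<xi>"
  shows "integral_solution (\<lambda>z. F (fst z) (snd z)) nonneg_time a b \<nu> x \<xi>"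
  unfolding integral_solution_def
proof (intro conjI ballI)
  show "continuous_on {a..b} \<xi>" using assms by (simp add: is_trajectory_def)
  fix t assume t: "t \<in> {a..b}"
  show "\<xi> t \<in> nonneg_time" using assms t by (simp add: is_trajectory_def E_t_nth)
  obtain K where K: "finite K"
    "\<forall>\<tau>\<in>{a..b} - K. (\<xi> has_vector_derivative F (\<xi> \<tau>) (\<nu> \<tau>)) (at \<tau> within {a..b})"
    using assms by (auto simp: is_trajectory_def)
  have "((\<lambda>\<sigma>. F (\<xi> \<sigma>) (\<nu> \<sigma>)) has_integral (\<xi> t - \<xi> a)) {a..t}"
  proof (rule fundamental_theorem_of_calculus_interior_strong[OF K(1)])
    show "a \<le> t" using t by simp
    show "continuous_on {a..t} \<xi>"
      using assms t by (auto simp: is_trajectory_def intro: continuous_on_subset)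
    show "(\<xi> has_vector_derivative F (\<xi> \<sigma>) (\<nu> \<sigma>)) (at \<sigma>)" if "\<sigma> \<in> {a<..<t} - K" for \<sigma>
      using bspec[OF K(2), of \<sigma>] that t by (simp add: at_within_Icc_at)
  qed
  then show "((\<lambda>\<sigma>. F (fst (\<xi> \<sigma>, \<nu> \<sigma>)) (snd (\<xi> \<sigma>, \<nu> \<sigma>))) has_integral (\<xi> t - x)) {a..t}"
    using assms by (simp add: is_trajectory_def)
qed

lemma control_linear: "linear (\<lambda>(U, S). control \<Gamma>u \<Gamma>s U S \<sigma>)"
  by (rule linearI) (auto simp: control_def vec_eq_iff inner_add_right sum.distrib algebra_simps sum_distrib_left)

lemma control_piecewise_continuous:
  assumes u: "\<And>j. piecewise_continuous_on a b (\<lambda>\<sigma>. \<Gamma>u \<sigma> $ j)"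
    and s: "\<And>j. piecewise_continuous_on a b (\<lambda>\<sigma>. \<Gamma>s \<sigma> $ j)"
  shows "piecewise_continuous_on a b (control \<Gamma>u \<Gamma>s U S)"
proof -
  have "piecewise_continuous_on a b (\<lambda>\<sigma>. \<chi> i. \<Sum>j\<in>UNIV. \<Gamma>u \<sigma> $ j * U $ (j, i))"
    by (rule piecewise_continuous_on_compose_UNIV[of "\<lambda>v. \<chi> i. \<Sum>j\<in>UNIV. v $ j * U $ (j, i)"])
      (intro continuous_intros piecewise_continuous_on_vec u)+
  moreover have "piecewise_continuous_on a b (\<lambda>\<sigma>. \<Gamma>s \<sigma> \<bullet> S)"
    by (rule piecewise_continuous_on_compose_UNIV[of "\<lambda>v. v \<bullet> S"])
      (intro continuous_intros piecewise_continuous_on_vec s)+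
  ultimately show ?thesis
    unfolding control_def[abs_def] by (rule piecewise_continuous_on_Pair)
qed

section \<open>Existence of trajectories\<close>

text \<open>The system is triangular: \<open>t\<close> is an integral of the dilation factor, \<open>x\<close> solves an equation with this
  \<open>t\<close> inserted, and \<open>y\<close> is an integral along both. Only \<open>x\<close> requires solving an equation, and there
  linear growth of \<open>f\<close> gives an a priori bound.\<close>

lemma trajectory_exists:
  fixes f :: "real \<times> (real^'nx) \<times> (real^'nu) \<Rightarrow> real^'nx" and x\<^sub>0 :: "real^'nx"
  assumes ab: "a \<le> b"
    and f: "continuously_differentiable_on f ({0..} \<times> UNIV)"
    and \<Lambda>: "continuous_on ({0..} \<times> UNIV) \<Lambda>"
    and growth: "\<And>K ti tf. compact K \<Longrightarrow> 0 \<le> ti \<Longrightarrow> ti < tf \<Longrightarrow>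
          \<exists>\<theta>>0. \<exists>\<rho>>0. \<forall>t\<in>{ti..tf}. \<forall>x. \<forall>u\<in>K. norm (f (t, x, u)) \<le> \<theta> * norm x + \<rho>"
    and \<nu>: "piecewise_continuous_on a b \<nu>"
    and time: "\<And>t. t \<in> {a..b} \<Longrightarrow> 0 \<le> t\<^sub>0 + integral {a..t} (\<lambda>\<sigma>. snd (\<nu> \<sigma>))"
  shows "\<exists>\<xi>. is_trajectory (aug_rhs f \<Lambda>) \<nu> a b (aug x\<^sub>0 y\<^sub>0 t\<^sub>0) \<xi>"
proof -
  define u where "u \<sigma> = fst (\<nu> \<sigma>)" for \<sigma>
  define s where "s \<sigma> = snd (\<nu> \<sigma>)" for \<sigma>
  have u: "piecewise_continuous_on a b u" and s: "piecewise_continuous_on a b s"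
    using piecewise_continuous_on_compose_UNIV[OF continuous_on_fst[OF continuous_on_id] \<nu>]
      piecewise_continuous_on_compose_UNIV[OF continuous_on_snd[OF continuous_on_id] \<nu>]
    by (simp_all add: u_def[abs_def] s_def[abs_def])
  define T where "T t = t\<^sub>0 + integral {a..t} s" for t
  have T0: "0 \<le> T t" if "t \<in> {a..b}" for t
    using time[OF that] by (simp add: T_def s_def[abs_def])
  have T_int: "(s has_integral (T t - t\<^sub>0)) {a..t}" if "t \<in> {a..b}" for t
    using that by (auto simp: T_def intro!: integrable_integral piecewise_continuous_on_integrable
        intro: piecewise_continuous_on_subset[OF s])
  have T_cont: "continuous_on {a..b} T"
    by (rule has_vector_derivative_of_has_integral(1)[OF s T_int])
  obtain Tm where Tm: "0 < Tm" "\<And>t. t \<in> {a..b} \<Longrightarrow> T t \<le> Tm"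
  proof -
    have "bounded (T ` {a..b})"
      by (intro compact_imp_bounded compact_continuous_image T_cont) simp
    then obtain M where "0 < M" "\<forall>y\<in>T ` {a..b}. norm y \<le> M" unfolding bounded_pos by blast
    then show ?thesis by (intro that[of M]) (auto simp: abs_le_iff)
  qed
  obtain Mu where Mu: "\<And>\<sigma>. \<sigma> \<in> {a..b} \<Longrightarrow> norm (u \<sigma>) \<le> Mu"
    using u unfolding piecewise_continuous_on_def bounded_iff by blast
  obtain Ms where Ms: "0 < Ms" "\<And>\<sigma>. \<sigma> \<in> {a..b} \<Longrightarrow> norm (s \<sigma>) \<le> Ms"
    using s unfolding piecewise_continuous_on_def bounded_pos by blast
  obtain \<theta> \<rho> where \<theta>: "0 < \<theta>" "0 < \<rho>"
    "\<forall>t\<in>{0..Tm}. \<forall>x. \<forall>u\<in>cball 0 Mu. norm (f (t, x, u)) \<le> \<theta> * norm x + \<rho>"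
    using growth[of "cball 0 Mu" 0 Tm] Tm(1) by auto
  \<comment> \<open>The a priori bound that the growth condition and Gronwall give for \<open>x\<close>; projecting \<open>x\<close> to this
    ball leaves the solution unchanged and makes \<open>f\<close> globally Lipschitz.\<close>
  define R where "R = (norm x\<^sub>0 + Ms * \<rho> * (b - a)) * exp (Ms * \<theta> * (b - a))"
  have R: "0 \<le> R" using Ms \<theta> ab by (simp add: R_def)
  define \<pi> where "\<pi> = closest_point (cball (0::real^'nx) R)"
  have ball: "convex (cball (0::real^'nx) R)" "closed (cball (0::real^'nx) R)" "cball (0::real^'nx) R \<noteq> {}"
    using R by auto
  have \<pi>: "\<pi> x \<in> cball 0 R" "norm (\<pi> x) \<le> norm x" "norm (\<pi> x - \<pi> y) \<le> norm (x - y)"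
    "norm x \<le> R \<Longrightarrow> \<pi> x = x" for x y
  proof -
    show "\<pi> x \<in> cball 0 R" unfolding \<pi>_def using ball by (intro closest_point_in_set)
    show lip: "norm (\<pi> x - \<pi> y) \<le> norm (x - y)" for x y
      using closest_point_lipschitz[OF ball, of x y] by (simp add: \<pi>_def dist_norm)
    show "norm x \<le> R \<Longrightarrow> \<pi> x = x" for x unfolding \<pi>_def by (intro closest_point_self) simp
    from this[of 0] R lip[of x 0] show "norm (\<pi> x) \<le> norm x" by simp
  qed
  have f_cont: "continuous_on ({0..} \<times> UNIV) f"
    by (rule continuously_differentiable_imp_continuous_on[OF f])
  obtain f' where f': "\<And>z. z \<in> {0..} \<times> UNIV \<Longrightarrow>
      (f has_derivative blinfun_apply (f' z)) (at z within {0..} \<times> UNIV)"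
    "continuous_on ({0..} \<times> UNIV) f'"
    by (rule continuously_differentiable_onE[OF f]) blast
  let ?C = "{0..Tm} \<times> cball (0::real^'nx) R \<times> cball (0::real^'nu) Mu"
  have C: "compact ?C" "convex ?C" "?C \<subseteq> {0..} \<times> UNIV"
    by (auto intro!: compact_Times convex_Times)
  obtain L where L: "0 \<le> L" "\<forall>y\<in>?C. \<forall>z\<in>?C. norm (f y - f z) \<le> L * norm (y - z)"
    using C1_lipschitz_on_compact[OF f' C] by blast
  define G where "G \<sigma> x = s \<sigma> *\<^sub>R f (T \<sigma>, \<pi> x, u \<sigma>)" for \<sigma> x
  have "\<exists>\<xi>. continuous_on {a..b} \<xi> \<and>
      (\<forall>t\<in>{a..b}. ((\<lambda>\<sigma>. G \<sigma> (\<xi> \<sigma>)) has_integral (\<xi> t - x\<^sub>0)) {a..t})"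
  proof (rule picard_lindeloef_global[OF ab, where x\<^sub>0 = x\<^sub>0 and G = G])
    show "0 \<le> Ms * L" using Ms L by simp
    fix \<sigma> and x y :: "real^'nx" assume \<sigma>: "\<sigma> \<in> {a..b}"
    have "norm (f (T \<sigma>, \<pi> x, u \<sigma>) - f (T \<sigma>, \<pi> y, u \<sigma>))
        \<le> L * norm ((T \<sigma>, \<pi> x, u \<sigma>) - (T \<sigma>, \<pi> y, u \<sigma>))"
      using T0[OF \<sigma>] Tm(2)[OF \<sigma>] \<pi>(1) Mu[OF \<sigma>] by (intro L(2)[rule_format]) auto
    also have "\<dots> = L * norm (\<pi> x - \<pi> y)" by (simp add: norm_Pair)
    also have "\<dots> \<le> L * norm (x - y)" using L \<pi>(3) by (intro mult_left_mono) auto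
    finally show "norm (G \<sigma> x - G \<sigma> y) \<le> Ms * L * norm (x - y)"
      using Ms(1) Ms(2)[OF \<sigma>] L(1) unfolding G_def scaleR_diff_right[symmetric] norm_scaleR
      by (simp add: mult.assoc mult_mono)
  next
    fix \<xi> :: "real \<Rightarrow> real^'nx" assume \<xi>: "continuous_on {a..b} \<xi>"
    have "piecewise_continuous_on a b (\<lambda>\<sigma>. (\<lambda>z. fst z *\<^sub>R f (snd z)) (s \<sigma>, (T \<sigma>, \<pi> (\<xi> \<sigma>), u \<sigma>)))"
    proof (rule piecewise_continuous_on_compose[where T = "UNIV \<times> ({0..} \<times> UNIV)"])
      show "continuous_on (UNIV \<times> ({0..} \<times> UNIV)) (\<lambda>z. fst z *\<^sub>R f (snd z))"
        by (intro continuous_intros continuous_on_compose2[OF f_cont]) auto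
      show "closed ((UNIV :: real set) \<times> ({0..} :: real set) \<times> (UNIV :: ((real^'nx) \<times> (real^'nu)) set))"
        by (intro closed_Times) auto
      have "continuous_on {a..b} (\<lambda>\<sigma>. \<pi> (\<xi> \<sigma>))"
        unfolding \<pi>_def by (rule continuous_on_compose2[OF continuous_on_closest_point[OF ball, of UNIV] \<xi>]) auto
      then show "piecewise_continuous_on a b (\<lambda>\<sigma>. (s \<sigma>, (T \<sigma>, \<pi> (\<xi> \<sigma>), u \<sigma>)))"
        by (intro piecewise_continuous_on_Pair s u continuous_imp_piecewise_continuous_on T_cont)
    qed (use T0 in auto)
    then show "(\<lambda>\<sigma>. G \<sigma> (\<xi> \<sigma>)) integrable_on {a..b}"
      unfolding G_def by (intro piecewise_continuous_on_integrable) simp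
  qed blast
  then obtain \<xi> where \<xi>: "continuous_on {a..b} \<xi>"
    "\<And>t. t \<in> {a..b} \<Longrightarrow> ((\<lambda>\<sigma>. G \<sigma> (\<xi> \<sigma>)) has_integral (\<xi> t - x\<^sub>0)) {a..t}" by blast
  have "norm (\<xi> t) \<le> R" if "t \<in> {a..b}" for t
    unfolding R_def
  proof (rule gronwall_has_integral[OF \<xi>(1) _ _ \<xi>(2) _ order_refl that])
    fix \<sigma> assume \<sigma>: "\<sigma> \<in> {a..b}"
    have "norm (f (T \<sigma>, \<pi> (\<xi> \<sigma>), u \<sigma>)) \<le> \<theta> * norm (\<pi> (\<xi> \<sigma>)) + \<rho>"
      using \<theta>(3) T0[OF \<sigma>] Tm(2)[OF \<sigma>] Mu[OF \<sigma>] by simp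
    also have "\<dots> \<le> \<theta> * norm (\<xi> \<sigma>) + \<rho>" using \<theta> \<pi>(2) by simp
    finally have "norm (G \<sigma> (\<xi> \<sigma>)) \<le> Ms * (\<theta> * norm (\<xi> \<sigma>) + \<rho>)"
      using Ms(1) Ms(2)[OF \<sigma>] unfolding G_def norm_scaleR by (intro mult_mono) auto
    then show "norm (G \<sigma> (\<xi> \<sigma>)) \<le> Ms * \<theta> * norm (\<xi> \<sigma>) + Ms * \<rho>" by (simp add: algebra_simps)
  qed (use Ms \<theta> in auto)
  then have G_eq: "G \<sigma> (\<xi> \<sigma>) = s \<sigma> *\<^sub>R f (T \<sigma>, \<xi> \<sigma>, u \<sigma>)" if "\<sigma> \<in> {a..b}" for \<sigma>
    using \<pi>(4) that by (simp add: G_def)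
  have pc: "piecewise_continuous_on a b (\<lambda>\<sigma>. (\<lambda>z. fst z *\<^sub>R \<phi> (snd z)) (s \<sigma>, (T \<sigma>, \<xi> \<sigma>, u \<sigma>)))"
    if \<phi>: "continuous_on ({0..} \<times> UNIV) \<phi>"
    for \<phi> :: "real \<times> (real^'nx) \<times> (real^'nu) \<Rightarrow> 'c::euclidean_space"
  proof (rule piecewise_continuous_on_compose[where T = "UNIV \<times> ({0..} \<times> UNIV)"])
    show "continuous_on (UNIV \<times> ({0..} \<times> UNIV)) (\<lambda>z. fst z *\<^sub>R \<phi> (snd z))"
      by (intro continuous_intros continuous_on_compose2[OF \<phi>]) auto
    show "closed ((UNIV :: real set) \<times> ({0..} :: real set) \<times> (UNIV :: ((real^'nx) \<times> (real^'nu)) set))"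
      by (intro closed_Times) auto
    show "piecewise_continuous_on a b (\<lambda>\<sigma>. (s \<sigma>, (T \<sigma>, \<xi> \<sigma>, u \<sigma>)))"
      by (intro piecewise_continuous_on_Pair s u continuous_imp_piecewise_continuous_on T_cont \<xi>(1))
  qed (use T0 in auto)
  have f_pc: "piecewise_continuous_on a b (\<lambda>\<sigma>. s \<sigma> *\<^sub>R f (T \<sigma>, \<xi> \<sigma>, u \<sigma>))"
    using pc[OF f_cont] by simp
  have \<Lambda>_pc: "piecewise_continuous_on a b (\<lambda>\<sigma>. s \<sigma> *\<^sub>R \<Lambda> (T \<sigma>, \<xi> \<sigma>, u \<sigma>))"
    using pc[OF \<Lambda>] by simp
  \<comment> \<open>\<open>\<Lambda>\<close> need not grow linearly, but \<open>y\<close> does not feed back into \<open>x\<close> and \<open>t\<close>, so \<open>y\<close> is obtained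
    by integration.\<close>
  define Y where "Y t = y\<^sub>0 + integral {a..t} (\<lambda>\<sigma>. s \<sigma> *\<^sub>R \<Lambda> (T \<sigma>, \<xi> \<sigma>, u \<sigma>))" for t
  have Y_int: "((\<lambda>\<sigma>. s \<sigma> *\<^sub>R \<Lambda> (T \<sigma>, \<xi> \<sigma>, u \<sigma>)) has_integral (Y t - y\<^sub>0)) {a..t}" if "t \<in> {a..b}" for t
    using that by (auto simp: Y_def intro!: integrable_integral piecewise_continuous_on_integrable
        intro: piecewise_continuous_on_subset[OF \<Lambda>_pc, simplified])
  define \<eta> where "\<eta> t = aug (\<xi> t) (Y t) (T t)" for t
  define \<phi> where "\<phi> \<sigma> = aug_rhs f \<Lambda> (\<eta> \<sigma>) (\<nu> \<sigma>)" for \<sigma>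
  have \<phi>: "\<phi> \<sigma> = aug (s \<sigma> *\<^sub>R f (T \<sigma>, \<xi> \<sigma>, u \<sigma>)) 0 0 +
      (s \<sigma> *\<^sub>R \<Lambda> (T \<sigma>, \<xi> \<sigma>, u \<sigma>)) *\<^sub>R aug 0 1 0 + s \<sigma> *\<^sub>R aug 0 0 1" for \<sigma>
    by (simp add: \<phi>_def \<eta>_def aug_rhs_aug u_def s_def vec_sum_2_eq_iff aug_nth)
  have \<phi>_pc: "piecewise_continuous_on a b \<phi>"
  proof -
    have "continuous_on UNIV (\<lambda>z::(real^'nx) \<times> real \<times> real. aug (fst z) 0 0 +
        fst (snd z) *\<^sub>R aug 0 1 0 + snd (snd z) *\<^sub>R aug 0 0 1)"
      by (intro continuous_intros bounded_linear.continuous_on[OF bounded_linear_aug])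
    from piecewise_continuous_on_compose_UNIV[OF this
        piecewise_continuous_on_Pair[OF f_pc piecewise_continuous_on_Pair[OF \<Lambda>_pc s]]]
    show ?thesis by (simp add: \<phi>[abs_def])
  qed
  have \<phi>_int: "(\<phi> has_integral (\<eta> t - aug x\<^sub>0 y\<^sub>0 t\<^sub>0)) {a..t}" if t: "t \<in> {a..b}" for t
  proof -
    have "((\<lambda>\<sigma>. s \<sigma> *\<^sub>R f (T \<sigma>, \<xi> \<sigma>, u \<sigma>)) has_integral (\<xi> t - x\<^sub>0)) {a..t}"
      by (rule has_integral_eq[OF _ \<xi>(2)[OF t]]) (use t G_eq in auto)
    from has_integral_linear[OF this bounded_linear_aug]
    have "(\<phi> has_integral (aug (\<xi> t - x\<^sub>0) 0 0 + (Y t - y\<^sub>0) *\<^sub>R aug 0 1 0 + (T t - t\<^sub>0) *\<^sub>R aug 0 0 1)) {a..t}"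
      unfolding \<phi>[abs_def] o_def
      by (intro has_integral_add has_integral_scaleR_left Y_int[OF t] T_int[OF t])
    moreover have "aug (\<xi> t - x\<^sub>0) 0 0 + (Y t - y\<^sub>0) *\<^sub>R aug 0 1 0 + (T t - t\<^sub>0) *\<^sub>R aug 0 0 1 =
        \<eta> t - aug x\<^sub>0 y\<^sub>0 t\<^sub>0"
      by (simp add: \<eta>_def vec_sum_2_eq_iff aug_nth)
    ultimately show ?thesis by simp
  qed
  have "is_trajectory (aug_rhs f \<Lambda>) \<nu> a b (aug x\<^sub>0 y\<^sub>0 t\<^sub>0) \<eta>"
    unfolding is_trajectory_def
  proof (intro conjI)
    show "continuous_on {a..b} \<eta>" by (rule has_vector_derivative_of_has_integral(1)[OF \<phi>_pc \<phi>_int])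
    show "\<eta> a = aug x\<^sub>0 y\<^sub>0 t\<^sub>0" by (rule has_integral_start[OF ab \<phi>_int])
    show "\<forall>\<tau>\<in>{a..b}. 0 \<le> (E_t *v \<eta> \<tau>) $ 1" using T0 by (simp add: \<eta>_def E_t_nth aug_nth)
    show "\<exists>K. finite K \<and> (\<forall>\<tau>\<in>{a..b} - K.
        (\<eta> has_vector_derivative aug_rhs f \<Lambda> (\<eta> \<tau>) (\<nu> \<tau>)) (at \<tau> within {a..b}))"
      using has_vector_derivative_of_has_integral(2)[OF \<phi>_pc \<phi>_int] by (simp add: \<phi>_def)
  qed
  then show ?thesis by blast
qed

lemma defect_domI:
  fixes f :: "real \<times> (real^'nx) \<times> (real^'nu) \<Rightarrow> real^'nx"
    and \<Gamma>u :: "real \<Rightarrow> real^'Nu" and \<Gamma>s :: "real \<Rightarrow> real^'Ns"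
  assumes ab: "a \<le> b"
    and f: "continuously_differentiable_on f ({0..} \<times> UNIV)"
    and \<Lambda>: "continuous_on ({0..} \<times> UNIV) \<Lambda>"
    and growth: "\<And>K ti tf. compact K \<Longrightarrow> 0 \<le> ti \<Longrightarrow> ti < tf \<Longrightarrow>
          \<exists>\<theta>>0. \<exists>\<rho>>0. \<forall>t\<in>{ti..tf}. \<forall>x. \<forall>u\<in>K. norm (f (t, x, u)) \<le> \<theta> * norm x + \<rho>"
    and u: "\<And>j. piecewise_continuous_on a b (\<lambda>\<sigma>. \<Gamma>u \<sigma> $ j)"
    and s: "\<And>j. piecewise_continuous_on a b (\<lambda>\<sigma>. \<Gamma>s \<sigma> $ j)"
    and time: "\<And>t. t \<in> {a..b} \<Longrightarrow> 0 \<le> x $ Inr 1 + integral {a..t} (\<lambda>\<sigma>. \<Gamma>s \<sigma> \<bullet> S)"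
  shows "(x, U, S) \<in> defect_dom (aug_rhs f \<Lambda>) \<Gamma>u \<Gamma>s a b"
proof -
  have "\<exists>\<xi>. is_trajectory (aug_rhs f \<Lambda>) (control \<Gamma>u \<Gamma>s U S) a b (aug (E_x *v x) (x $ Inr 0) (x $ Inr 1)) \<xi>"
    by (rule trajectory_exists[OF ab f \<Lambda> growth control_piecewise_continuous[OF u s]])
      (use time in \<open>auto simp: control_def\<close>)
  then show ?thesis by (simp add: aug_collect defect_dom_def)
qed

section \<open>The penalty along a trajectory\<close>

lemma penalty_C1:
  assumes g: "continuously_differentiable_on g D" and h: "continuously_differentiable_on h D"
    and q: "\<And>i. q i C1_differentiable_on UNIV" and p: "\<And>j. p j C1_differentiable_on UNIV"
  shows "continuously_differentiable_on (penalty q p g h) D"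
proof -
  have "continuously_differentiable_on
      (\<lambda>z. (\<Sum>i\<in>UNIV. q i (g z $ i)) + (\<Sum>j\<in>UNIV. p j (h z $ j))) D"
    by (intro continuously_differentiable_on_add continuously_differentiable_on_sum
        continuously_differentiable_on_compose[OF C1_differentiable_imp_continuously_differentiable_on[OF q]]
        continuously_differentiable_on_compose[OF C1_differentiable_imp_continuously_differentiable_on[OF p]]
        continuously_differentiable_on_linear_compose[OF bounded_linear_vec_nth] g h) auto
  then show ?thesis unfolding penalty_def[abs_def] .
qed

text \<open>\<open>\<phi>\<close> has a minimum at \<open>\<gamma> z\<close>, so its derivative there is \<open>0\<close>. Since \<open>\<phi>\<close> lives on the whole line, this also
  covers points \<open>z\<close> on the boundary of \<open>D\<close>, where a nonnegative function on \<open>D\<close> may vanish with a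
  nonzero derivative.\<close>

lemma nonneg_compose_has_derivative_0:
  fixes \<phi> :: "real \<Rightarrow> real"
  assumes C1: "\<phi> C1_differentiable_on UNIV" and nonneg: "\<And>r. 0 \<le> \<phi> r" and zero: "\<phi> (\<gamma> z) = 0"
    and \<gamma>: "(\<gamma> has_derivative \<gamma>') (at z within D)"
  shows "((\<lambda>z. \<phi> (\<gamma> z)) has_derivative (\<lambda>_. 0)) (at z within D)"
proof -
  obtain l where l: "(\<phi> has_vector_derivative l) (at (\<gamma> z))"
    using C1 unfolding C1_differentiable_on_def by blast
  then have "DERIV \<phi> (\<gamma> z) :> l" by (simp add: has_real_derivative_iff_has_vector_derivative)
  then have "l = 0" by (rule DERIV_local_min[of _ _ _ 1]) (use nonneg zero in auto)
  then have "(\<phi> has_derivative (\<lambda>_. 0)) (at (\<gamma> z))"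
    using l by (simp add: has_vector_derivative_def)
  from has_derivative_compose[OF \<gamma> this] show ?thesis .
qed

lemma penalty_has_derivative_0:
  assumes g: "continuously_differentiable_on g D" and h: "continuously_differentiable_on h D"
    and q: "\<And>i. q i C1_differentiable_on UNIV" "\<And>i r. 0 \<le> q i r"
    and p: "\<And>j. p j C1_differentiable_on UNIV" "\<And>j r. 0 \<le> p j r"
    and z: "z \<in> D" "penalty q p g h z = 0"
  shows "(penalty q p g h has_derivative (\<lambda>_. 0)) (at z within D)"
proof -
  have "0 \<le> (\<Sum>i\<in>UNIV. q i (g z $ i))" "0 \<le> (\<Sum>j\<in>UNIV. p j (h z $ j))"
    using q p by (auto intro: sum_nonneg)
  then have "(\<Sum>i\<in>UNIV. q i (g z $ i)) = 0" "(\<Sum>j\<in>UNIV. p j (h z $ j)) = 0"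
    using z(2) unfolding penalty_def by linarith+
  then have 0: "q i (g z $ i) = 0" "p j (h z $ j) = 0" for i j
    using q p by (simp_all add: sum_nonneg_eq_0_iff)
  obtain g' where g': "(g has_derivative g') (at z within D)"
    using continuously_differentiable_onE[OF g] z(1) by metis
  obtain h' where h': "(h has_derivative h') (at z within D)"
    using continuously_differentiable_onE[OF h] z(1) by metis
  have dq: "((\<lambda>z. q i (g z $ i)) has_derivative (\<lambda>_. 0)) (at z within D)" for i
    by (rule nonneg_compose_has_derivative_0[where \<gamma> = "\<lambda>z. g z $ i",
          OF q 0(1) bounded_linear.has_derivative[OF bounded_linear_vec_nth g']])
  have dp: "((\<lambda>z. p j (h z $ j)) has_derivative (\<lambda>_. 0)) (at z within D)" for j
    by (rule nonneg_compose_has_derivative_0[where \<gamma> = "\<lambda>z. h z $ j",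
          OF p 0(2) bounded_linear.has_derivative[OF bounded_linear_vec_nth h']])
  show ?thesis
    using has_derivative_add[OF has_derivative_sum[where I = UNIV, OF dq] has_derivative_sum[where I = UNIV, OF dp]]
    by (simp add: penalty_def[abs_def])
qed

lemma aug_rhs_rate_stationary:
  assumes \<Lambda>: "(\<Lambda> has_derivative (\<lambda>_. 0)) (at (data_point z) within {0..} \<times> UNIV)" "\<Lambda> (data_point z) = 0"
  shows "((\<lambda>z. aug_rhs f \<Lambda> (fst z) (snd z) $ Inr 0) has_derivative (\<lambda>_. 0)) (at z within nonneg_time \<times> UNIV)"
proof -
  have "(data_point has_derivative data_point) (at z within nonneg_time \<times> UNIV)"
    by (rule bounded_linear_imp_has_derivative[OF bounded_linear_data_point])
  from has_derivative_in_compose[OF this has_derivative_subset[OF \<Lambda>(1) data_point_image]]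
  have "((\<lambda>z. snd (snd z) * \<Lambda> (data_point z)) has_derivative
      (\<lambda>h. snd (snd z) * 0 + snd (snd h) * \<Lambda> (data_point z))) (at z within nonneg_time \<times> UNIV)"
    by (intro has_derivative_mult bounded_linear_imp_has_derivative
        bounded_linear_compose[OF bounded_linear_snd bounded_linear_snd])
  then show ?thesis by (simp add: aug_rhs_eq aug_nth \<Lambda>(2))
qed

text \<open>The integral of the nonnegative rate \<open>s * \<Lambda>\<close> is the increment of \<open>y\<close>, which is \<open>0\<close>.\<close>

lemma penalty_rate_zero:
  fixes f :: "real \<times> (real^'nx) \<times> (real^'nu) \<Rightarrow> real^'nx"
  assumes f: "continuously_differentiable_on f ({0..} \<times> UNIV)"
    and \<Lambda>: "continuously_differentiable_on \<Lambda> ({0..} \<times> UNIV)" "\<And>z. 0 \<le> \<Lambda> z"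
    and ab: "a \<le> b" and \<nu>: "piecewise_continuous_on a b \<nu>"
    and pos: "\<And>\<sigma>. \<sigma> \<in> {a..b} \<Longrightarrow> 0 < snd (\<nu> \<sigma>)"
    and \<xi>: "is_trajectory (aug_rhs f \<Lambda>) \<nu> a b x \<xi>" and returns: "\<xi> b $ Inr 0 = x $ Inr 0"
  shows "\<exists>K. finite K \<and> (\<forall>\<sigma>\<in>{a..b} - K. \<Lambda> (data_point (\<xi> \<sigma>, \<nu> \<sigma>)) = 0)"
proof -
  have sol: "integral_solution (\<lambda>z. aug_rhs f \<Lambda> (fst z) (snd z)) nonneg_time a b \<nu> x \<xi>"
    by (rule is_trajectory_imp_integral_solution[OF \<xi>])
  let ?\<phi> = "\<lambda>\<sigma>. snd (\<nu> \<sigma>) * \<Lambda> (data_point (\<xi> \<sigma>, \<nu> \<sigma>))"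
  have rate: "aug_rhs f \<Lambda> z w $ Inr 0 = snd w * \<Lambda> (data_point (z, w))" for z w
    using aug_rhs_eq[of f \<Lambda> "(z, w)"] by (simp add: aug_nth)
  have "piecewise_continuous_on a b (\<lambda>\<sigma>. (\<lambda>z. aug_rhs f \<Lambda> (fst z) (snd z) $ Inr 0) (\<xi> \<sigma>, \<nu> \<sigma>))"
  proof (rule piecewise_continuous_on_compose[where T = "nonneg_time \<times> UNIV"])
    show "continuous_on (nonneg_time \<times> UNIV) (\<lambda>z. aug_rhs f \<Lambda> (fst z) (snd z) $ Inr 0)"
      by (intro continuous_intros continuously_differentiable_imp_continuous_on aug_rhs_C1 f \<Lambda>)
    show "closed (nonneg_time \<times> UNIV)" using nonneg_time by (intro closed_Times) auto
    show "piecewise_continuous_on a b (\<lambda>\<sigma>. (\<xi> \<sigma>, \<nu> \<sigma>))"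
      using sol by (intro piecewise_continuous_on_Pair \<nu> continuous_imp_piecewise_continuous_on)
        (simp add: integral_solution_def)
  qed (use sol in \<open>auto simp: integral_solution_def\<close>)
  then have pc: "piecewise_continuous_on a b ?\<phi>" by (simp add: rate)
  have "((\<lambda>\<sigma>. aug_rhs f \<Lambda> (fst (\<xi> \<sigma>, \<nu> \<sigma>)) (snd (\<xi> \<sigma>, \<nu> \<sigma>))) has_integral (\<xi> b - x)) {a..b}"
    using sol ab unfolding integral_solution_def by auto
  from has_integral_linear[OF this bounded_linear_vec_nth[of "Inr 0"]]
  have zero: "(?\<phi> has_integral 0) {a..b}"
    using returns by (simp add: o_def rate)
  have nonneg: "0 \<le> ?\<phi> \<sigma>" if "\<sigma> \<in> {a..b}" for \<sigma>
    using pos[OF that] \<Lambda>(2) by (simp add: less_imp_le)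
  obtain K where K: "finite K" "\<forall>\<sigma>\<in>{a..b} - K. ?\<phi> \<sigma> = 0"
    using nonneg_has_integral_0_imp_zero[OF pc nonneg zero] by blast
  have "\<Lambda> (data_point (\<xi> \<sigma>, \<nu> \<sigma>)) = 0" if "\<sigma> \<in> {a..b} - K" for \<sigma>
    using bspec[OF K(2) that] pos[of \<sigma>] that by auto
  then show ?thesis using K(1) by blast
qed

section \<open>The gradients of the defect\<close>

lemma is_trajectory_trajectory:
  assumes "(x, U, S) \<in> defect_dom F \<Gamma>u \<Gamma>s a b"
  shows "is_trajectory F (control \<Gamma>u \<Gamma>s U S) a b x (trajectory F (control \<Gamma>u \<Gamma>s U S) a b x)"
proof -
  have "\<exists>\<xi>. is_trajectory F (control \<Gamma>u \<Gamma>s U S) a b x \<xi>"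
    using assms by (simp add: defect_dom_def)
  then show ?thesis unfolding trajectory_def by (rule someI_ex)
qed

lemma defect_eq_endpoint:
  assumes "(x, U, S) \<in> defect_dom F \<Gamma>u \<Gamma>s a b" and ab: "a \<le> b"
  shows "defect F \<Gamma>u \<Gamma>s a b x' x U S = x' - trajectory F (control \<Gamma>u \<Gamma>s U S) a b x b"
proof -
  have "((\<lambda>\<sigma>. F (trajectory F (control \<Gamma>u \<Gamma>s U S) a b x \<sigma>) (control \<Gamma>u \<Gamma>s U S \<sigma>)) has_integral
      (trajectory F (control \<Gamma>u \<Gamma>s U S) a b x b - x)) {a..b}"
    using is_trajectory_imp_integral_solution[OF is_trajectory_trajectory[OF assms(1)]] ab
    by (simp add: integral_solution_def)
  then show ?thesis by (simp add: defect_def Let_def integral_unique)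
qed

text \<open>If the rate of \<open>y\<close> is stationary along the trajectory, then the \<open>y\<close> row of the right-hand side of the
  variational equation is zero, and the \<open>y\<close> component of its solution keeps its initial value.\<close>

lemma endpoint_map_has_derivative:
  fixes F :: "real^('nx::finite + 2) \<Rightarrow> (real^'nu) \<times> real \<Rightarrow> real^('nx + 2)"
    and \<Gamma>u :: "real \<Rightarrow> real^'Nu" and \<Gamma>s :: "real \<Rightarrow> real^'Ns"
    and U :: "real^('Nu \<times> 'nu)" and S :: "real^'Ns"
  assumes C1: "continuously_differentiable_on (\<lambda>z. F (fst z) (snd z)) (nonneg_time \<times> UNIV)"
    and ab: "a \<le> b"
    and u: "\<And>j. piecewise_continuous_on a b (\<lambda>\<sigma>. \<Gamma>u \<sigma> $ j)"
    and s: "\<And>j. piecewise_continuous_on a b (\<lambda>\<sigma>. \<Gamma>s \<sigma> $ j)"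
    and dom: "(x, U, S) \<in> defect_dom F \<Gamma>u \<Gamma>s a b"
    and K: "finite K"
    and stationary: "\<And>\<sigma>. \<sigma> \<in> {a..b} - K \<Longrightarrow>
      ((\<lambda>z. F (fst z) (snd z) $ Inr 0) has_derivative (\<lambda>_. 0))
        (at (trajectory F (control \<Gamma>u \<Gamma>s U S) a b x \<sigma>, control \<Gamma>u \<Gamma>s U S \<sigma>) within nonneg_time \<times> UNIV)"
  obtains D where
    "((\<lambda>p. trajectory F (control \<Gamma>u \<Gamma>s (fst (snd p)) (snd (snd p))) a b (fst p) b) has_derivative D)
       (at (x, U, S) within defect_dom F \<Gamma>u \<Gamma>s a b)"
    "\<And>h. D h $ Inr 0 = fst h $ Inr 0"
proof -
  define c where "c \<sigma> p = control \<Gamma>u \<Gamma>s (fst (snd p)) (snd (snd p)) \<sigma>"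
    for \<sigma> and p :: "(real^('nx + 2)) \<times> (real^('Nu \<times> 'nu)) \<times> (real^'Ns)"
  define \<xi> where "\<xi> p = trajectory F (control \<Gamma>u \<Gamma>s (fst (snd p)) (snd (snd p))) a b (fst p)"
    for p :: "(real^('nx + 2)) \<times> (real^('Nu \<times> 'nu)) \<times> (real^'Ns)"
  obtain F' where F': "\<And>z. z \<in> nonneg_time \<times> UNIV \<Longrightarrow>
      ((\<lambda>z. F (fst z) (snd z)) has_derivative blinfun_apply (F' z)) (at z within nonneg_time \<times> UNIV)"
    "continuous_on (nonneg_time \<times> UNIV) F'"
    by (rule continuously_differentiable_onE[OF C1]) blast
  let ?p = "(x, U, S)"
  have lin: "linear (c \<sigma>)" for \<sigma>
  proof -
    have "linear ((\<lambda>(U, S). control \<Gamma>u \<Gamma>s U S \<sigma>) \<circ> snd)"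
      by (intro linear_compose control_linear linear_snd)
    then show ?thesis by (simp add: c_def[abs_def] o_def split_beta)
  qed
  have pc: "piecewise_continuous_on a b (\<lambda>\<sigma>. c \<sigma> p)" for p
    using control_piecewise_continuous[OF u s] by (simp add: c_def)
  have sol: "integral_solution (\<lambda>z. F (fst z) (snd z)) nonneg_time a b (\<lambda>\<sigma>. c \<sigma> p) (fst p) (\<xi> p)"
    if "p \<in> defect_dom F \<Gamma>u \<Gamma>s a b" for p
    using is_trajectory_imp_integral_solution[OF is_trajectory_trajectory, of "fst p" "fst (snd p)" "snd (snd p)"] that
    by (simp add: c_def \<xi>_def)
  obtain D \<zeta> where D: "((\<lambda>p. \<xi> p b) has_derivative D) (at ?p within defect_dom F \<Gamma>u \<Gamma>s a b)"
    and \<zeta>: "\<And>h t. t \<in> {a..b} \<Longrightarrow>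
      ((\<lambda>\<sigma>. F' (\<xi> ?p \<sigma>, c \<sigma> ?p) (\<zeta> h \<sigma>, c \<sigma> h)) has_integral (\<zeta> h t - fst h)) {a..t}"
    and \<zeta>b: "\<And>h. \<zeta> h b = D h"
    using endpoint_has_derivative[OF nonneg_time F' ab bounded_linear_fst lin pc sol dom] by blast
  have F'0: "F' (\<xi> ?p \<sigma>, c \<sigma> ?p) v $ Inr 0 = 0" if \<sigma>: "\<sigma> \<in> {a..b} - K" for \<sigma> v
  proof -
    let ?z = "(\<xi> ?p \<sigma>, c \<sigma> ?p)"
    have z: "?z \<in> nonneg_time \<times> UNIV"
      using sol[OF dom] \<sigma> by (auto simp: integral_solution_def)
    have "((\<lambda>z. F (fst z) (snd z) $ Inr 0) has_derivative (\<lambda>v. F' ?z v $ Inr 0)) (at ?z within nonneg_time \<times> UNIV)"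
      by (rule bounded_linear.has_derivative[OF bounded_linear_vec_nth F'(1)[OF z]])
    moreover have "((\<lambda>z. F (fst z) (snd z) $ Inr 0) has_derivative (\<lambda>_. 0)) (at ?z within nonneg_time \<times> UNIV)"
      using stationary[OF \<sigma>] by (simp add: \<xi>_def c_def)
    ultimately have "(\<lambda>v. F' ?z v $ Inr 0) = (\<lambda>_. 0)"
      by (rule frechet_derivative_unique_within) (rule coordinate_step_nonneg_time_Times[OF z])
    then show ?thesis by metis
  qed
  have "D h $ Inr 0 = fst h $ Inr 0" for h
  proof -
    have "((\<lambda>\<sigma>. F' (\<xi> ?p \<sigma>, c \<sigma> ?p) (\<zeta> h \<sigma>, c \<sigma> h)) has_integral (D h - fst h)) {a..b}"
      using \<zeta>[of b h] ab by (simp add: \<zeta>b)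
    from has_integral_linear[OF this bounded_linear_vec_nth[of "Inr 0"]]
    have 1: "((\<lambda>\<sigma>. F' (\<xi> ?p \<sigma>, c \<sigma> ?p) (\<zeta> h \<sigma>, c \<sigma> h) $ Inr 0) has_integral (D h - fst h) $ Inr 0) {a..b}"
      by (simp add: o_def)
    have 2: "((\<lambda>\<sigma>. F' (\<xi> ?p \<sigma>, c \<sigma> ?p) (\<zeta> h \<sigma>, c \<sigma> h) $ Inr 0) has_integral 0) {a..b}"
      by (rule has_integral_spike_finite[OF K _ has_integral_0]) (simp add: F'0)
    show ?thesis using has_integral_unique[OF 1 2] by simp
  qed
  then show ?thesis using D that unfolding \<xi>_def by blast
qed

text \<open>The partial gradients are obtained by composing the derivative of the end point map with the affine
  maps \<open>\<iota>\<close> that vary a single argument.\<close>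

lemma defect_slice_has_derivative:
  assumes D: "((\<lambda>p. trajectory F (control \<Gamma>u \<Gamma>s (fst (snd p)) (snd (snd p))) a b (fst p) b) has_derivative D)
       (at (\<iota> v) within defect_dom F \<Gamma>u \<Gamma>s a b)"
    and \<iota>: "(\<iota> has_derivative \<iota>') (at v within W)" and v: "v \<in> W"
    and W: "\<And>v. v \<in> W \<Longrightarrow> \<iota> v \<in> defect_dom F \<Gamma>u \<Gamma>s a b" and ab: "a \<le> b"
  shows "((\<lambda>v. defect F \<Gamma>u \<Gamma>s a b x' (fst (\<iota> v)) (fst (snd (\<iota> v))) (snd (snd (\<iota> v)))) has_derivative
    (\<lambda>h. - D (\<iota>' h))) (at v within W)"
proof -
  let ?E = "\<lambda>p. trajectory F (control \<Gamma>u \<Gamma>s (fst (snd p)) (snd (snd p))) a b (fst p) b"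
  have "\<iota> ` W \<subseteq> defect_dom F \<Gamma>u \<Gamma>s a b" using W by auto
  from has_derivative_in_compose[OF \<iota> has_derivative_subset[OF D this]]
  have "((\<lambda>v. x' - ?E (\<iota> v)) has_derivative (\<lambda>h. 0 - D (\<iota>' h))) (at v within W)"
    by (intro has_derivative_diff has_derivative_const)
  then have *: "((\<lambda>v. x' - ?E (\<iota> v)) has_derivative (\<lambda>h. - D (\<iota>' h))) (at v within W)" by simp
  show ?thesis
  proof (rule has_derivative_transform[OF v _ *])
    fix v assume "v \<in> W"
    then have "(fst (\<iota> v), fst (snd (\<iota> v)), snd (snd (\<iota> v))) \<in> defect_dom F \<Gamma>u \<Gamma>s a b" using W by simp
    from defect_eq_endpoint[OF this ab]
    show "defect F \<Gamma>u \<Gamma>s a b x' (fst (\<iota> v)) (fst (snd (\<iota> v))) (snd (snd (\<iota> v))) = x' - ?E (\<iota> v)" .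
  qed
qed

theorem lemma10:
  fixes f :: "real \<times> (real^'nx) \<times> (real^'nu) \<Rightarrow> real^'nx"
    and g :: "real \<times> (real^'nx) \<times> (real^'nu) \<Rightarrow> real^'ng"
    and h :: "real \<times> (real^'nx) \<times> (real^'nu) \<Rightarrow> real^'nh"
    and q :: "'ng \<Rightarrow> real \<Rightarrow> real" and p :: "'nh \<Rightarrow> real \<Rightarrow> real"
    and F :: "real^('nx + 2) \<Rightarrow> (real^'nu) \<times> real \<Rightarrow> real^('nx + 2)"
    and \<Gamma>u :: "real \<Rightarrow> real^'Nu" and \<Gamma>s :: "real \<Rightarrow> real^'Ns"
    and N :: nat and \<tau> :: "nat \<Rightarrow> real"
    and X :: "nat \<Rightarrow> real^('nx + 2)" and U :: "real^('Nu \<times> 'nu)" and S :: "real^'Ns"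
  assumes f_C1: "continuously_differentiable_on f ({0..} \<times> UNIV)"
    and g_C1: "continuously_differentiable_on g ({0..} \<times> UNIV)"
    and h_C1: "continuously_differentiable_on h ({0..} \<times> UNIV)"
    and f_growth: "\<And>K ti tf. compact K \<Longrightarrow> 0 \<le> ti \<Longrightarrow> ti < tf \<Longrightarrow>
          \<exists>\<theta>>0. \<exists>\<rho>>0. \<forall>t\<in>{ti..tf}. \<forall>x. \<forall>u\<in>K. norm (f (t, x, u)) \<le> \<theta> * norm x + \<rho>"
    and q_C1: "\<And>i. q i C1_differentiable_on UNIV"
    and q_zero: "\<And>i z. z \<le> 0 \<Longrightarrow> q i z = 0"
    and q_pos: "\<And>i z. 0 < z \<Longrightarrow> 0 < q i z"
    and p_C1: "\<And>j. p j C1_differentiable_on UNIV"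
    and p_zero: "\<And>j. p j 0 = 0"
    and p_pos: "\<And>j z. z \<noteq> 0 \<Longrightarrow> 0 < p j z"
    and F_eq: "F = aug_rhs f (penalty q p g h)"
    and \<Gamma>u_poly: "\<And>j. piecewise_polynomial_on {0..1} (\<lambda>\<sigma>. \<Gamma>u \<sigma> $ j)"
    and \<Gamma>s_poly: "\<And>j. piecewise_polynomial_on {0..1} (\<lambda>\<sigma>. \<Gamma>s \<sigma> $ j)"
    and grid: "2 \<le> N" "\<tau> 1 = 0" "\<tau> N = 1" "\<And>k. k \<in> {1..<N} \<Longrightarrow> \<tau> k < \<tau> (k + 1)"
    and initial_time: "0 \<le> (E_t *v X 1) $ 1"
    and dilation_pos: "\<And>\<sigma>. \<sigma> \<in> {0..1} \<Longrightarrow> 0 < \<Gamma>s \<sigma> \<bullet> S"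
    and defect_zero: "\<And>k. k \<in> {1..<N} \<Longrightarrow>
          defect F \<Gamma>u \<Gamma>s (\<tau> k) (\<tau> (k + 1)) (X (k + 1)) (X k) U S = 0"
    and y_const: "\<And>k. k \<in> {1..<N} \<Longrightarrow> E_y *v (X (k + 1) - X k) = 0"
  shows "\<forall>k\<in>{1..<N}.
    (let F\<^sub>k = defect F \<Gamma>u \<Gamma>s (\<tau> k) (\<tau> (k + 1));
         D = defect_dom F \<Gamma>u \<Gamma>s (\<tau> k) (\<tau> (k + 1));
         at_next = at (X (k + 1));
         at_cur = at (X k) within {x. (x, U, S) \<in> D};
         at_U = at U within {V. (X k, V, S) \<in> D};
         at_S = at S within {R. (X k, U, R) \<in> D}
     in (X k, U, S) \<in> D \<and>
        (\<lambda>x. F\<^sub>k x (X k) U S) differentiable at_next \<and>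
        E_y ** jacobian (\<lambda>x. F\<^sub>k x (X k) U S) at_next = (\<chi> i. aug 0 1 0) \<and>
        (\<lambda>x. F\<^sub>k (X (k + 1)) x U S) differentiable at_cur \<and>
        E_y ** jacobian (\<lambda>x. F\<^sub>k (X (k + 1)) x U S) at_cur = (\<chi> i. aug 0 (-1) 0) \<and>
        (\<lambda>V. F\<^sub>k (X (k + 1)) (X k) V S) differentiable at_U \<and>
        E_y ** jacobian (\<lambda>V. F\<^sub>k (X (k + 1)) (X k) V S) at_U = 0 \<and>
        (\<lambda>R. F\<^sub>k (X (k + 1)) (X k) U R) differentiable at_S \<and>
        E_y ** jacobian (\<lambda>R. F\<^sub>k (X (k + 1)) (X k) U R) at_S = 0)"
proof (intro ballI)
  have q_nonneg: "0 \<le> q i r" for i r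
    using q_zero[of r i] q_pos[of r i] by (cases "r \<le> 0") auto
  have p_nonneg: "0 \<le> p j r" for j r
    using p_zero[of j] p_pos[of r j] by (cases "r = 0") auto
  define \<Lambda> where "\<Lambda> = penalty q p g h"
  have F: "F = aug_rhs f \<Lambda>" using F_eq by (simp add: \<Lambda>_def)
  have \<Lambda>_C1: "continuously_differentiable_on \<Lambda> ({0..} \<times> UNIV)"
    unfolding \<Lambda>_def by (rule penalty_C1[OF g_C1 h_C1 q_C1 p_C1])
  have \<Lambda>_cont: "continuous_on ({0..} \<times> UNIV) \<Lambda>"
    by (rule continuously_differentiable_imp_continuous_on[OF \<Lambda>_C1])
  have \<Lambda>_nonneg: "0 \<le> \<Lambda> z" for z
    unfolding \<Lambda>_def penalty_def using q_nonneg p_nonneg by (intro add_nonneg_nonneg sum_nonneg) auto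
  have F_C1: "continuously_differentiable_on (\<lambda>z. F (fst z) (snd z)) (nonneg_time \<times> UNIV)"
    unfolding F by (rule aug_rhs_C1[OF f_C1 \<Lambda>_C1])
  have grid_mono: "\<tau> i \<le> \<tau> j" if "1 \<le> i" "i \<le> j" "j \<le> N" for i j
    using that(2,3)
  proof (induction rule: dec_induct)
    case (step j)
    then show ?case using grid(4)[of j] that(1) by simp
  qed simp
  have grid_01: "0 \<le> \<tau> k" "\<tau> k < \<tau> (k + 1)" "\<tau> (k + 1) \<le> 1" if "k \<in> {1..<N}" for k
    using grid_mono[of 1 k] grid_mono[of "k + 1" N] grid(2-4) that by auto
  have \<Gamma>_pc: "piecewise_continuous_on (\<tau> k) (\<tau> (k + 1)) (\<lambda>\<sigma>. \<Gamma>u \<sigma> $ j)"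
      "piecewise_continuous_on (\<tau> k) (\<tau> (k + 1)) (\<lambda>\<sigma>. \<Gamma>s \<sigma> $ i)" if "k \<in> {1..<N}" for k i j
    using grid_01[OF that] piecewise_polynomial_imp_piecewise_continuous[OF \<Gamma>u_poly]
      piecewise_polynomial_imp_piecewise_continuous[OF \<Gamma>s_poly]
    by (auto intro: piecewise_continuous_on_subset)
  have dilation_pc: "piecewise_continuous_on (\<tau> k) (\<tau> (k + 1)) (\<lambda>\<sigma>. \<Gamma>s \<sigma> \<bullet> R)"
    if "k \<in> {1..<N}" for k R
    using piecewise_continuous_on_compose_UNIV[OF _ control_piecewise_continuous[OF \<Gamma>_pc(1,2)[OF that]],
        of snd U R] by (simp add: control_def continuous_on_snd)
  have dilation: "0 < \<Gamma>s \<sigma> \<bullet> S" if "k \<in> {1..<N}" "\<sigma> \<in> {\<tau> k..\<tau> (k + 1)}" for k \<sigma>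
    using grid_01[OF that(1)] that(2) by (intro dilation_pos) auto
  have domI: "(x, V, R) \<in> defect_dom F \<Gamma>u \<Gamma>s (\<tau> k) (\<tau> (k + 1))"
    if k: "k \<in> {1..<N}"
      and "\<And>t. t \<in> {\<tau> k..\<tau> (k + 1)} \<Longrightarrow> 0 \<le> x $ Inr 1 + integral {\<tau> k..t} (\<lambda>\<sigma>. \<Gamma>s \<sigma> \<bullet> R)"
    for k x V R
    unfolding F using grid_01[OF k] that(2)
    by (intro defect_domI[OF _ f_C1 \<Lambda>_cont f_growth \<Gamma>_pc[OF k]]) auto
  have domI_S: "(x, V, S) \<in> defect_dom F \<Gamma>u \<Gamma>s (\<tau> k) (\<tau> (k + 1))"
    if k: "k \<in> {1..<N}" and x: "x \<in> nonneg_time" for k x V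
  proof (rule domI[OF k])
    fix t assume t: "t \<in> {\<tau> k..\<tau> (k + 1)}"
    have "0 \<le> integral {\<tau> k..t} (\<lambda>\<sigma>. \<Gamma>s \<sigma> \<bullet> S)"
    proof (rule integral_nonneg)
      show "(\<lambda>\<sigma>. \<Gamma>s \<sigma> \<bullet> S) integrable_on {\<tau> k..t}"
        using t by (intro piecewise_continuous_on_integrable piecewise_continuous_on_subset[OF dilation_pc[OF k]]) auto
      show "0 \<le> \<Gamma>s \<sigma> \<bullet> S" if "\<sigma> \<in> {\<tau> k..t}" for \<sigma>
        using dilation[OF k, of \<sigma>] that t by auto
    qed
    then show "0 \<le> x $ Inr 1 + integral {\<tau> k..t} (\<lambda>\<sigma>. \<Gamma>s \<sigma> \<bullet> S)" using x by simp
  qed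
  let ?\<xi> = "\<lambda>k. trajectory F (control \<Gamma>u \<Gamma>s U S) (\<tau> k) (\<tau> (k + 1)) (X k)"
  \<comment> \<open>A vanishing defect says that the trajectory on the \<open>k\<close>-th interval ends in \<open>X (k + 1)\<close>. This
    propagates nonnegativity of the time component along the grid.\<close>
  have shooting: "X (k + 1) = ?\<xi> k (\<tau> (k + 1))" if k: "k \<in> {1..<N}" and "X k \<in> nonneg_time" for k
    using defect_eq_endpoint[OF domI_S[OF that]] grid_01[OF k] defect_zero[OF k] by simp
  have time: "X k \<in> nonneg_time" if "1 \<le> k" "k \<le> N" for k
    using that
  proof (induction k rule: dec_induct)
    case base
    then show ?case using initial_time by (simp add: E_t_nth)
  next
    case (step k)
    then have k: "k \<in> {1..<N}" and Xk: "X k \<in> nonneg_time" by auto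
    have "?\<xi> k (\<tau> (k + 1)) \<in> nonneg_time"
      using is_trajectory_imp_integral_solution[OF is_trajectory_trajectory[OF domI_S[OF k Xk, of U]]] grid_01[OF k]
      by (simp add: integral_solution_def)
    then show ?case using shooting[OF k Xk] by simp
  qed
  fix k assume k: "k \<in> {1..<N}"
  define a where "a = \<tau> k"
  define b where "b = \<tau> (k + 1)"
  note ab = grid_01[OF k, folded a_def b_def]
  have ab': "a \<le> b" using ab by simp
  define D where "D = defect_dom F \<Gamma>u \<Gamma>s a b"
  note domI = domI[OF k, folded a_def b_def, folded D_def] and domI_S = domI_S[OF k, folded a_def b_def, folded D_def]
    and pc = \<Gamma>_pc[OF k, folded a_def b_def]
  have Xk: "X k \<in> nonneg_time" using time k by simp
  have mem: "(X k, U, S) \<in> D" by (rule domI_S[OF Xk])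
  define \<nu> where "\<nu> = control \<Gamma>u \<Gamma>s U S"
  define \<xi> where "\<xi> = trajectory F \<nu> a b (X k)"
  have traj: "is_trajectory (aug_rhs f \<Lambda>) \<nu> a b (X k) \<xi>"
    using is_trajectory_trajectory[OF mem[unfolded D_def]] by (simp add: \<xi>_def \<nu>_def F)
  have "X (k + 1) = \<xi> b"
    using shooting[OF k Xk] by (simp add: \<xi>_def \<nu>_def a_def b_def)
  moreover have "X (k + 1) $ Inr 0 = X k $ Inr 0"
    using y_const[OF k] by (simp add: E_y_mult vec_eq_iff)
  \<comment> \<open>The \<open>y\<close> component returns to its initial value, so the penalty vanishes
    along the trajectory except at finitely many times.\<close>
  ultimately have returns: "\<xi> b $ Inr 0 = X k $ Inr 0" by simp
  have "0 < snd (\<nu> \<sigma>)" if "\<sigma> \<in> {a..b}" for \<sigma>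
    using dilation[OF k] that by (simp add: \<nu>_def control_def a_def b_def)
  from penalty_rate_zero[OF f_C1 \<Lambda>_C1 \<Lambda>_nonneg ab' _ this traj returns]
  obtain K where K: "finite K" "\<forall>\<sigma>\<in>{a..b} - K. \<Lambda> (data_point (\<xi> \<sigma>, \<nu> \<sigma>)) = 0"
    using control_piecewise_continuous[OF pc] unfolding \<nu>_def by blast
  have stationary: "((\<lambda>z. F (fst z) (snd z) $ Inr 0) has_derivative (\<lambda>_. 0))
      (at (\<xi> \<sigma>, \<nu> \<sigma>) within nonneg_time \<times> UNIV)" if \<sigma>: "\<sigma> \<in> {a..b} - K" for \<sigma>
  proof -
    have "\<xi> \<sigma> \<in> nonneg_time"
      using is_trajectory_imp_integral_solution[OF traj] \<sigma> by (simp add: integral_solution_def)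
    then have z: "data_point (\<xi> \<sigma>, \<nu> \<sigma>) \<in> {0..} \<times> UNIV" by (simp add: data_point_def)
    have zero: "\<Lambda> (data_point (\<xi> \<sigma>, \<nu> \<sigma>)) = 0" using K(2) \<sigma> by blast
    have "(\<Lambda> has_derivative (\<lambda>_. 0)) (at (data_point (\<xi> \<sigma>, \<nu> \<sigma>)) within {0..} \<times> UNIV)"
      unfolding \<Lambda>_def
      by (rule penalty_has_derivative_0[OF g_C1 h_C1 q_C1 q_nonneg p_C1 p_nonneg z zero[unfolded \<Lambda>_def]])
    then show ?thesis unfolding F using zero by (rule aug_rhs_rate_stationary)
  qed
  obtain D' where D': "((\<lambda>p. trajectory F (control \<Gamma>u \<Gamma>s (fst (snd p)) (snd (snd p))) a b (fst p) b)
        has_derivative D') (at (X k, U, S) within defect_dom F \<Gamma>u \<Gamma>s a b)"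
    and D'y: "\<And>h. D' h $ Inr 0 = fst h $ Inr 0"
    by (rule endpoint_map_has_derivative[OF F_C1 ab' pc mem[unfolded D_def] K(1)
          stationary[unfolded \<xi>_def \<nu>_def]]) (assumption, rule that)
  let ?F = "defect F \<Gamma>u \<Gamma>s a b"
  have next_der: "((\<lambda>x. ?F x (X k) U S) has_derivative (\<lambda>h. h)) (at (X (k + 1)))"
    unfolding defect_def Let_def by (auto intro!: derivative_eq_intros)
  have cur_der: "((\<lambda>x. ?F (X (k + 1)) x U S) has_derivative (\<lambda>h. - D' (h, 0, 0)))
      (at (X k) within {x. (x, U, S) \<in> D})"
  proof -
    have "((\<lambda>x. (x, U, S)) has_derivative (\<lambda>h. (h, 0, 0))) (at (X k) within {x. (x, U, S) \<in> D})"
      by (intro has_derivative_Pair has_derivative_ident has_derivative_const)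
    from defect_slice_has_derivative[where F = F and \<Gamma>u = \<Gamma>u and \<Gamma>s = \<Gamma>s and a = a and b = b and D = D'
        and \<iota> = "\<lambda>x. (x, U, S)" and v = "X k" and x' = "X (k + 1)", OF D' this _ _ ab', folded D_def,
        unfolded fst_conv snd_conv mem_Collect_eq]
    show ?thesis using mem by blast
  qed
  have U_der: "((\<lambda>V. ?F (X (k + 1)) (X k) V S) has_derivative (\<lambda>h. - D' (0, h, 0)))
      (at U within {V. (X k, V, S) \<in> D})"
  proof -
    have "((\<lambda>V. (X k, V, S)) has_derivative (\<lambda>h. (0, h, 0))) (at (U) within {V. (X k, V, S) \<in> D})"
      by (intro has_derivative_Pair has_derivative_ident has_derivative_const)
    from defect_slice_has_derivative[where F = F and \<Gamma>u = \<Gamma>u and \<Gamma>s = \<Gamma>s and a = a and b = b and D = D'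
        and \<iota> = "\<lambda>V. (X k, V, S)" and v = "U" and x' = "X (k + 1)", OF D' this _ _ ab', folded D_def,
        unfolded fst_conv snd_conv mem_Collect_eq]
    show ?thesis using mem by blast
  qed
  have S_der: "((\<lambda>R. ?F (X (k + 1)) (X k) U R) has_derivative (\<lambda>h. - D' (0, 0, h)))
      (at S within {R. (X k, U, R) \<in> D})"
  proof -
    have "((\<lambda>R. (X k, U, R)) has_derivative (\<lambda>h. (0, 0, h))) (at (S) within {R. (X k, U, R) \<in> D})"
      by (intro has_derivative_Pair has_derivative_ident has_derivative_const)
    from defect_slice_has_derivative[where F = F and \<Gamma>u = \<Gamma>u and \<Gamma>s = \<Gamma>s and a = a and b = b and D = D'
        and \<iota> = "\<lambda>R. (X k, U, R)" and v = "S" and x' = "X (k + 1)", OF D' this _ _ ab', folded D_def,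
        unfolded fst_conv snd_conv mem_Collect_eq]
    show ?thesis using mem by blast
  qed
  \<comment> \<open>The derivatives within the parameter sets are unique because each set contains arbitrarily
    short steps from the base point along every coordinate axis.\<close>
  have cur_step: "\<exists>d. 0 < \<bar>d\<bar> \<and> \<bar>d\<bar> < e \<and> X k + d *\<^sub>R i \<in> {x. (x, U, S) \<in> D}"
    if "i \<in> Basis" "0 < e" for i e
    using coordinate_step_nonneg_time[OF Xk that] domI_S by blast
  have U_dom: "{V. (X k, V, S) \<in> D} = UNIV" using domI_S[OF Xk] by blast
  have S_step: "\<exists>d. 0 < \<bar>d\<bar> \<and> \<bar>d\<bar> < e \<and> S + d *\<^sub>R i \<in> {R. (X k, U, R) \<in> D}"
    if i: "i \<in> Basis" and e: "0 < e" for i e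
  proof -
    obtain j where j: "i = axis j 1" using i by (auto simp: Basis_vec_def)
    obtain d where d: "0 < \<bar>d\<bar>" "\<bar>d\<bar> < e"
      "\<And>t. t \<in> {a..b} \<Longrightarrow> 0 \<le> integral {a..t} (\<lambda>\<sigma>. \<Gamma>s \<sigma> \<bullet> S + d * \<Gamma>s \<sigma> $ j)"
      using perturbed_integral_nonneg[OF ab dilation_pc[OF k, folded a_def b_def]
          dilation[OF k, folded a_def b_def] \<Gamma>s_poly e] by blast
    have "(X k, U, S + d *\<^sub>R i) \<in> D"
    proof (rule domI)
      fix t assume "t \<in> {a..b}"
      then show "0 \<le> X k $ Inr 1 + integral {a..t} (\<lambda>\<sigma>. \<Gamma>s \<sigma> \<bullet> (S + d *\<^sub>R i))"
        using d(3)[of t] Xk by (simp add: j inner_add_right inner_axis)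
    qed
    then show ?thesis using d by blast
  qed
  note next_J = selector_mult_jacobian[OF next_der coordinate_step_UNIV, of E_y "\<chi> i. aug 0 1 0"]
    and cur_J = selector_mult_jacobian[OF cur_der cur_step, of E_y "\<chi> i. aug 0 (-1) 0"]
    and U_J = selector_mult_jacobian[OF U_der[unfolded U_dom] coordinate_step_UNIV, of E_y 0]
    and S_J = selector_mult_jacobian[OF S_der S_step, of E_y 0]
  show "let F\<^sub>k = defect F \<Gamma>u \<Gamma>s (\<tau> k) (\<tau> (k + 1));
         D = defect_dom F \<Gamma>u \<Gamma>s (\<tau> k) (\<tau> (k + 1));
         at_next = at (X (k + 1));
         at_cur = at (X k) within {x. (x, U, S) \<in> D};
         at_U = at U within {V. (X k, V, S) \<in> D};
         at_S = at S within {R. (X k, U, R) \<in> D}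
     in (X k, U, S) \<in> D \<and>
        (\<lambda>x. F\<^sub>k x (X k) U S) differentiable at_next \<and>
        E_y ** jacobian (\<lambda>x. F\<^sub>k x (X k) U S) at_next = (\<chi> i. aug 0 1 0) \<and>
        (\<lambda>x. F\<^sub>k (X (k + 1)) x U S) differentiable at_cur \<and>
        E_y ** jacobian (\<lambda>x. F\<^sub>k (X (k + 1)) x U S) at_cur = (\<chi> i. aug 0 (-1) 0) \<and>
        (\<lambda>V. F\<^sub>k (X (k + 1)) (X k) V S) differentiable at_U \<and>
        E_y ** jacobian (\<lambda>V. F\<^sub>k (X (k + 1)) (X k) V S) at_U = 0 \<and>
        (\<lambda>R. F\<^sub>k (X (k + 1)) (X k) U R) differentiable at_S \<and>
        E_y ** jacobian (\<lambda>R. F\<^sub>k (X (k + 1)) (X k) U R) at_S = 0"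
    unfolding Let_def a_def[symmetric] b_def[symmetric] D_def[symmetric] U_dom
    by (intro conjI mem next_J cur_J U_J S_J) (simp_all add: E_y_mult aug_row_mult D'y vec_eq_iff)
qed

end
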